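(* A category with subobjects is isomorphic to the category $\mathbb{L}(S)$ of principal left ideals of some locally inverse semigroup $S$ if and only if it is unambiguous. (Isomorphic means: there is an isomorphism of categories which, together with its inverse, preserves inclusions.)
   Context: A regular semigroup $S$ is locally inverse if $eSe$ is an inverse semigroup for every idempotent $e\in E(S)$, where $E(S)$ is the set of idempotents of $S$. Semigroups and small categories are nonempty. Morphisms are composed from left to right; $v\mathcal{C}$ is the object set of a small category $\mathcal{C}$. A category with subobjects is a pair $(\mathcal{C},\mathcal{P})$ (often written $\mathcal{C}$), with $\mathcal{C}$ a small category and $\mathcal{P}$ a subcategory with $v\mathcal{P}=v\mathcal{C}$ such that (1) $\mathcal{P}$ is a strict preorder (at most one morphism between any two objects, only identities are isomorphisms in $\mathcal P$); (2) every morphism of $\mathcal{P}$ is a monomorphism in $\mathcal{C}$; (3) if $\varphi,\psi\in\mathcal{P}$ and $\varphi=\alpha\psi$ with $\alpha\in\mathcal{C}$, then $\alpha\in\mathcal{P}$. Morphisms of $\mathcal{P}$ are called inclusions; if there is an inclusion $c'\to c$ we write $c'\subseteq c$ and denote it $\iota(c',c)$. An inclusion $\iota(c',c)$ splits if there is $\theta\in\mathcal{C}(c,c')$ with $\iota(c',c)\theta=1_{c'}$; such $\theta$ is called a retraction. A normal factorisation of $\varphi$ is $\varphi=\theta\sigma\iota$ with $\theta$ a retraction, $\sigma$ an isomorphism, $\iota$ an inclusion. A normal cone with apex $d$ is a map $\gamma\colon v\mathcal{C}\to\mathcal{C}$ with $\gamma(a)\in\mathcal{C}(a,d)$ for all $a$,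 $\iota(a,b)\gamma(b)=\gamma(a)$ whenever $a\subseteq b$, and at least one component $\gamma(c)$ an isomorphism. A category $\mathcal{C}$ is unambiguous if: (UC 1) it is a category with subobjects; (UC 2) every inclusion splits uniquely; (UC 3) every morphism has a unique normal factorisation; (UC 4) for each $c\in v\mathcal{C}$ there is a normal cone $\mu$ with $\mu(c)=1_c$. For a regular semigroup $S$, the category $\mathbb{L}(S)$ has objects $Se$, $e\in E(S)$; morphisms $Se\to Sf$ are the maps $\rho(e,u,f)\colon Se\to Sf$, $x\mapsto xu$, with $u\in eSf$; composition is composition of maps. Its inclusions are the morphisms $\rho(e,e,f)$ with $Se\subseteq Sf$. *)

theory Defs
  imports "HOL-Library.FuncSet"
begin

record 's sgrp =
  Car :: "'s set"
  mul :: "'s \<Rightarrow> 's \<Rightarrow> 's"  (infixl \<open>\<odot>\<index>\<close> 70)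

locale nonempty_semigroup =
  fixes S :: "'s sgrp" (structure)
  assumes nonempty: "Car S \<noteq> {}"
    and closed: "\<lbrakk>x \<in> Car S; y \<in> Car S\<rbrakk> \<Longrightarrow> x \<odot> y \<in> Car S"
    and assoc: "\<lbrakk>x \<in> Car S; y \<in> Car S; z \<in> Car S\<rbrakk> \<Longrightarrow> (x \<odot> y) \<odot> z = x \<odot> (y \<odot> z)"

locale regular_semigroup = nonempty_semigroup +
  assumes regular: "x \<in> Car S \<Longrightarrow> \<exists>y\<in>Car S. x \<odot> y \<odot> x = x"

locale inverse_semigroup = nonempty_semigroup +
  assumes unique_inverse:
    "x \<in> Car S \<Longrightarrow> \<exists>!y. y \<in> Car S \<and> x \<odot> y \<odot> x = x \<and> y \<odot> x \<odot> y = y"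

definition idems :: "'s sgrp \<Rightarrow> 's set" where
  "idems S = {e \<in> Car S. e \<odot>\<^bsub>S\<^esub> e = e}"

definition corner :: "'s sgrp \<Rightarrow> 's \<Rightarrow> 's \<Rightarrow> 's set" where
  "corner S e f = {e \<odot>\<^bsub>S\<^esub> x \<odot>\<^bsub>S\<^esub> f | x. x \<in> Car S}"

locale locally_inverse_semigroup = regular_semigroup +
  assumes locally_inverse: "e \<in> idems S \<Longrightarrow> inverse_semigroup (S\<lparr>Car := corner S e e\<rparr>)"

text \<open>
  Composition is written from left to right: \<open>f \<cdot> g\<close> is meaningful when \<open>Cod f = Dom g\<close>;
  the value of \<open>\<cdot>\<close> on other pairs is irrelevant.
\<close>

record ('o, 'm) category =
  Obj :: "'o set"
  Mor :: "'m set"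
  Dom :: "'m \<Rightarrow> 'o"
  Cod :: "'m \<Rightarrow> 'o"
  Idt :: "'o \<Rightarrow> 'm"
  cmp :: "'m \<Rightarrow> 'm \<Rightarrow> 'm"  (infixl \<open>\<cdot>\<index>\<close> 70)

definition Hom :: "('o, 'm, 'x) category_scheme \<Rightarrow> 'o \<Rightarrow> 'o \<Rightarrow> 'm set" where
  "Hom C a b = {f \<in> Mor C. Dom C f = a \<and> Cod C f = b}"

locale small_category =
  fixes C :: "('o, 'm, 'x) category_scheme" (structure)
  assumes Obj_nonempty: "Obj C \<noteq> {}"
    and Dom_Obj: "f \<in> Mor C \<Longrightarrow> Dom C f \<in> Obj C"
    and Cod_Obj: "f \<in> Mor C \<Longrightarrow> Cod C f \<in> Obj C"
    and Idt_Hom: "a \<in> Obj C \<Longrightarrow> Idt C a \<in> Hom C a a"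
    and cmp_Hom: "\<lbrakk>f \<in> Hom C a b; g \<in> Hom C b c\<rbrakk> \<Longrightarrow> f \<cdot> g \<in> Hom C a c"
    and cmp_Idt_left: "f \<in> Hom C a b \<Longrightarrow> Idt C a \<cdot> f = f"
    and cmp_Idt_right: "f \<in> Hom C a b \<Longrightarrow> f \<cdot> Idt C b = f"
    and cmp_assoc: "\<lbrakk>f \<in> Hom C a b; g \<in> Hom C b c; h \<in> Hom C c d\<rbrakk>
      \<Longrightarrow> (f \<cdot> g) \<cdot> h = f \<cdot> (g \<cdot> h)"

definition is_iso :: "('o, 'm, 'x) category_scheme \<Rightarrow> 'm \<Rightarrow> bool" where
  "is_iso C f \<longleftrightarrow> f \<in> Mor C \<and>
    (\<exists>g \<in> Hom C (Cod C f) (Dom C f).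
       f \<cdot>\<^bsub>C\<^esub> g = Idt C (Dom C f) \<and> g \<cdot>\<^bsub>C\<^esub> f = Idt C (Cod C f))"

text \<open>With left-to-right composition, monomorphisms are the right cancellable morphisms.\<close>

definition is_mono :: "('o, 'm, 'x) category_scheme \<Rightarrow> 'm \<Rightarrow> bool" where
  "is_mono C f \<longleftrightarrow> f \<in> Mor C \<and>
    (\<forall>a \<in> Obj C. \<forall>g \<in> Hom C a (Dom C f). \<forall>h \<in> Hom C a (Dom C f).
       g \<cdot>\<^bsub>C\<^esub> f = h \<cdot>\<^bsub>C\<^esub> f \<longrightarrow> g = h)"

definition is_functor ::
  "('o, 'm, 'x) category_scheme \<Rightarrow> ('p, 'n, 'y) category_scheme \<Rightarrow> ('o \<Rightarrow> 'p) \<Rightarrow> ('m \<Rightarrow> 'n) \<Rightarrow> bool"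
  where
  "is_functor C D F\<^sub>o F\<^sub>m \<longleftrightarrow>
     F\<^sub>o \<in> Obj C \<rightarrow> Obj D \<and> F\<^sub>m \<in> Mor C \<rightarrow> Mor D \<and>
     (\<forall>f \<in> Mor C. Dom D (F\<^sub>m f) = F\<^sub>o (Dom C f) \<and> Cod D (F\<^sub>m f) = F\<^sub>o (Cod C f)) \<and>
     (\<forall>a \<in> Obj C. F\<^sub>m (Idt C a) = Idt D (F\<^sub>o a)) \<and>
     (\<forall>f \<in> Mor C. \<forall>g \<in> Mor C. Cod C f = Dom C g \<longrightarrow> F\<^sub>m (f \<cdot>\<^bsub>C\<^esub> g) = F\<^sub>m f \<cdot>\<^bsub>D\<^esub> F\<^sub>m g)"

text \<open>
  The subcategory \<open>\<P>\<close> has the same objects as \<open>\<C>\<close>, so it is determined by its set \<open>Incl\<close>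
  of morphisms.
\<close>

record ('o, 'm) subobj_category = "('o, 'm) category" +
  Incl :: "'m set"

definition incl_cat :: "('o, 'm) subobj_category \<Rightarrow> ('o, 'm) category" where
  "incl_cat C =
     \<lparr>Obj = Obj C, Mor = Incl C, Dom = Dom C, Cod = Cod C, Idt = Idt C, cmp = cmp C\<rparr>"

locale category_with_subobjects = small_category C
  for C :: "('o, 'm) subobj_category" (structure) +
  assumes Incl_Mor: "Incl C \<subseteq> Mor C"
    and incl_subcategory: "small_category (incl_cat C)"
    and Incl_preorder: "\<lbrakk>j \<in> Hom (incl_cat C) a b; k \<in> Hom (incl_cat C) a b\<rbrakk> \<Longrightarrow> j = k"
    and Incl_strict: "is_iso (incl_cat C) j \<Longrightarrow> \<exists>a \<in> Obj C. j = Idt C a"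
    and Incl_mono: "j \<in> Incl C \<Longrightarrow> is_mono C j"
    and Incl_factor: "\<lbrakk>j \<in> Incl C; k \<in> Incl C; f \<in> Mor C; Cod C f = Dom C k; j = f \<cdot> k\<rbrakk>
      \<Longrightarrow> f \<in> Incl C"

definition splits_by :: "('o, 'm) subobj_category \<Rightarrow> 'm \<Rightarrow> 'm \<Rightarrow> bool" where
  "splits_by C j r \<longleftrightarrow> j \<in> Incl C \<and> r \<in> Hom C (Cod C j) (Dom C j) \<and> j \<cdot>\<^bsub>C\<^esub> r = Idt C (Dom C j)"

definition is_retraction :: "('o, 'm) subobj_category \<Rightarrow> 'm \<Rightarrow> bool" where
  "is_retraction C r \<longleftrightarrow> (\<exists>j. splits_by C j r)"

fun is_normal_factorisation :: "('o, 'm) subobj_category \<Rightarrow> 'm \<Rightarrow> 'm \<times> 'm \<times> 'm \<Rightarrow> bool" where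
  "is_normal_factorisation C f (r, s, j) \<longleftrightarrow>
     is_retraction C r \<and> is_iso C s \<and> j \<in> Incl C \<and>
     Cod C r = Dom C s \<and> Cod C s = Dom C j \<and> f = r \<cdot>\<^bsub>C\<^esub> s \<cdot>\<^bsub>C\<^esub> j"

definition is_normal_cone :: "('o, 'm) subobj_category \<Rightarrow> 'o \<Rightarrow> ('o \<Rightarrow> 'm) \<Rightarrow> bool" where
  "is_normal_cone C d \<gamma> \<longleftrightarrow>
     d \<in> Obj C \<and>
     (\<forall>a \<in> Obj C. \<gamma> a \<in> Hom C a d) \<and>
     (\<forall>j \<in> Incl C. j \<cdot>\<^bsub>C\<^esub> \<gamma> (Cod C j) = \<gamma> (Dom C j)) \<and>
     (\<exists>c \<in> Obj C. is_iso C (\<gamma> c))"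

locale unambiguous_category = category_with_subobjects +
  assumes incl_splits_uniquely: "j \<in> Incl C \<Longrightarrow> \<exists>!r. splits_by C j r"
    and unique_normal_factorisation: "f \<in> Mor C \<Longrightarrow> \<exists>!F. is_normal_factorisation C f F"
    and normal_cone_at: "c \<in> Obj C \<Longrightarrow> \<exists>d \<mu>. is_normal_cone C d \<mu> \<and> \<mu> c = Idt C c"

definition subobj_isomorphic ::
  "('o, 'm) subobj_category \<Rightarrow> ('p, 'n) subobj_category \<Rightarrow> bool" where
  "subobj_isomorphic C D \<longleftrightarrow>
     (\<exists>F\<^sub>o F\<^sub>m G\<^sub>o G\<^sub>m.
        is_functor C D F\<^sub>o F\<^sub>m \<and> is_functor D C G\<^sub>o G\<^sub>m \<and>
        (\<forall>a \<in> Obj C. G\<^sub>o (F\<^sub>o a) = a) \<and> (\<forall>f \<in> Mor C. G\<^sub>m (F\<^sub>m f) = f) \<and>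
        (\<forall>b \<in> Obj D. F\<^sub>o (G\<^sub>o b) = b) \<and> (\<forall>g \<in> Mor D. F\<^sub>m (G\<^sub>m g) = g) \<and>
        F\<^sub>m ` Incl C \<subseteq> Incl D \<and> G\<^sub>m ` Incl D \<subseteq> Incl C)"

definition left_ideal :: "'s sgrp \<Rightarrow> 's \<Rightarrow> 's set" where
  "left_ideal S e = {x \<odot>\<^bsub>S\<^esub> e | x. x \<in> Car S}"

text \<open>
  A map \<open>A \<rightarrow> B\<close> is the triple of its domain, its values (a function that is \<open>undefined\<close>
  outside \<open>A\<close>, so that equal maps are equal triples) and its codomain.
\<close>

type_synonym 's set_map = "'s set \<times> ('s \<Rightarrow> 's) \<times> 's set"

definition rho :: "'s sgrp \<Rightarrow> 's \<Rightarrow> 's \<Rightarrow> 's \<Rightarrow> 's set_map" where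
  "rho S e u f = (left_ideal S e, (\<lambda>x\<in>left_ideal S e. x \<odot>\<^bsub>S\<^esub> u), left_ideal S f)"

fun map_cmp :: "'s set_map \<Rightarrow> 's set_map \<Rightarrow> 's set_map" where
  "map_cmp (A, f, B) (B', g, D) = (A, compose A g f, D)"

definition L_cat :: "'s sgrp \<Rightarrow> ('s set, 's set_map) subobj_category" where
  "L_cat S =
     \<lparr>Obj = {left_ideal S e | e. e \<in> idems S},
      Mor = {rho S e u f | e u f. e \<in> idems S \<and> f \<in> idems S \<and> u \<in> corner S e f},
      Dom = (\<lambda>(A, f, B). A),
      Cod = (\<lambda>(A, f, B). B),
      Idt = (\<lambda>A. (A, (\<lambda>x\<in>A. x), A)),
      cmp = map_cmp,
      Incl = {rho S e e f | e f.
        e \<in> idems S \<and> f \<in> idems S \<and> left_ideal S e \<subseteq> left_ideal S f}\<rparr>"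

end

theory Submission
  imports Defs
begin

text \<open>
  If \<open>S\<close> is locally inverse, morphisms \<open>Se \<rightarrow> Sf\<close> of \<open>\<bbbL>(S)\<close> correspond to elements of \<open>eSf\<close>, and the
  two uniqueness requirements hold because \<open>\<L>\<close>-related (or \<open>\<R>\<close>-related) idempotents of an inverse
  monoid \<open>eSe\<close> are mutually inverse, hence equal.

  Conversely, the normal cones of an unambiguous category form a regular semigroup under
  \<open>(\<gamma>\<delta>)(a) = \<gamma>(a) \<delta>(c)\<degree>\<close>, where \<open>c\<close> is the apex of \<open>\<gamma>\<close> and \<open>f\<degree> = \<theta>\<sigma>\<close> is the epimorphic
  component of \<open>f = \<theta>\<sigma>\<iota>\<close>; equivalently, \<open>f\<degree>\<close> is the unique split epimorphism with \<open>f = f\<degree>\<iota>\<close> for an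
  inclusion \<open>\<iota>\<close>. The idempotents are the cones with \<open>\<epsilon>(c) = 1\<close> at their apex \<open>c\<close>, and the left ideal of
  such an \<open>\<epsilon>\<close> consists of the cones with apex below \<open>c\<close>, so objects correspond to principal
  left ideals. A morphism \<open>f\<close> from \<open>c\<close> acts on these cones by \<open>\<gamma> \<mapsto> \<gamma> (\<iota>(b,c) f)\<degree>\<close> with \<open>b\<close> the apex of \<open>\<gamma>\<close>.
  The local submonoid at \<open>\<epsilon>\<close> embeds into the endomorphism monoid of \<open>c\<close>, where the inverse of
  \<open>\<theta>\<sigma>\<iota>\<close> can only be the composite of the retraction of \<open>\<iota>\<close>, \<open>\<sigma>\<inverse>\<close> and the inclusion split by \<open>\<theta>\<close>.
\<close>

section \<open>The category of principal left ideals\<close>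

lemma (in nonempty_semigroup) idemsD:
  assumes "e \<in> idems S"
  shows "e \<in> Car S" "e \<odot> e = e"
  using assms by (auto simp: idems_def)

lemma (in nonempty_semigroup) left_ideal_iff:
  assumes "e \<in> idems S"
  shows "x \<in> left_ideal S e \<longleftrightarrow> x \<in> Car S \<and> x \<odot> e = x"
  using idemsD[OF assms] unfolding left_ideal_def by (auto simp: closed assoc) metis

text \<open>Idempotency turns the sandwich form into two absorption laws, so that later computations
  are purely equational.\<close>

lemma (in nonempty_semigroup) corner_iff:
  assumes "e \<in> idems S" "f \<in> idems S"
  shows "u \<in> corner S e f \<longleftrightarrow> u \<in> Car S \<and> e \<odot> u = u \<and> u \<odot> f = u"
proof -
  note ef = idemsD[OF assms(1)] idemsD[OF assms(2)]
  have "e \<odot> (e \<odot> x \<odot> f) = e \<odot> x \<odot> f" if "x \<in> Car S" for x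
    using ef that by (metis assoc closed)
  moreover have "(e \<odot> x \<odot> f) \<odot> f = e \<odot> x \<odot> f" if "x \<in> Car S" for x
    using ef that by (metis assoc closed)
  ultimately show ?thesis
    using ef unfolding corner_def by (auto simp: closed) metis
qed

lemma (in nonempty_semigroup) left_ideal_subset_iff:
  assumes "e \<in> idems S" "f \<in> idems S"
  shows "left_ideal S e \<subseteq> left_ideal S f \<longleftrightarrow> e \<odot> f = e"
proof -
  note ef = idemsD[OF assms(1)] idemsD[OF assms(2)]
  show ?thesis
    using ef assoc[of _ e f] by (auto simp: left_ideal_iff[OF assms(1)] left_ideal_iff[OF assms(2)] subset_iff)
      metis
qed

lemma rho_Dom_Cod [simp]:
  "Dom (L_cat S) (rho S e u f) = left_ideal S e"
  "Cod (L_cat S) (rho S e u f) = left_ideal S f"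
  by (simp_all add: rho_def L_cat_def)

section \<open>Morphisms of \<open>L_cat S\<close> and their representing elements\<close>

context nonempty_semigroup
begin

text \<open>Evaluating at \<open>e\<close>, which lies in its own left ideal, gives back
  \<open>u\<close> because \<open>e u = u\<close>.\<close>

lemma rho_eq_iff:
  assumes "e \<in> idems S" "f \<in> idems S" "f' \<in> idems S" "u \<in> corner S e f" "u' \<in> corner S e f'"
  shows "rho S e u f = rho S e u' f' \<longleftrightarrow> u = u' \<and> left_ideal S f = left_ideal S f'"
proof -
  have e: "e \<in> left_ideal S e"
    using assms by (simp add: left_ideal_iff idemsD)
  have "u = u'" if "(\<lambda>x\<in>left_ideal S e. x \<odot> u) = (\<lambda>x\<in>left_ideal S e. x \<odot> u')"
    using fun_cong[OF that, of e] e assms by (simp add: corner_iff)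
  then show ?thesis by (auto simp: rho_def)
qed

lemma rho_cmp:
  assumes "e \<in> idems S" "f \<in> idems S" "g \<in> idems S" "u \<in> corner S e f" "v \<in> corner S f g"
  shows "rho S e u f \<cdot>\<^bsub>L_cat S\<^esub> rho S f v g = rho S e (u \<odot> v) g"
    and "u \<odot> v \<in> corner S e g"
proof -
  note c = idemsD[OF assms(1)] idemsD[OF assms(2)] idemsD[OF assms(3)]
    assms(4)[unfolded corner_iff[OF assms(1,2)]] assms(5)[unfolded corner_iff[OF assms(2,3)]]
  show "u \<odot> v \<in> corner S e g"
    using c by (simp add: corner_iff assms closed assoc) (metis assoc)
  have "x \<odot> u \<in> left_ideal S f" "x \<odot> u \<odot> v = x \<odot> (u \<odot> v)" if "x \<in> left_ideal S e" for x
    using c that by (simp_all add: left_ideal_iff assms closed assoc)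
  then show "rho S e u f \<cdot>\<^bsub>L_cat S\<^esub> rho S f v g = rho S e (u \<odot> v) g"
    by (auto simp: L_cat_def rho_def compose_def intro!: restrict_ext)
qed

lemma rho_Idt:
  assumes "e \<in> idems S"
  shows "Idt (L_cat S) (left_ideal S e) = rho S e e e" and "e \<in> corner S e e"
  using assms by (auto simp: L_cat_def rho_def left_ideal_iff corner_iff idemsD intro!: restrict_ext)

text \<open>Elements of \<open>Se\<close> satisfy \<open>x e = x\<close>. Hence an inclusion depends
  only on the two ideals, not on the idempotents that generate them.\<close>

lemma rho_incl:
  assumes "e \<in> idems S"
  shows "rho S e e f = (left_ideal S e, (\<lambda>x\<in>left_ideal S e. x), left_ideal S f)"
  using assms by (auto simp: rho_def left_ideal_iff intro!: restrict_ext)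

text \<open>Different idempotents may generate the same left ideal. As \<open>x e' = x\<close> on
  it, multiplying by \<open>u\<close> is the same as multiplying by \<open>e' u\<close>.\<close>

lemma rho_change_idem:
  assumes "e \<in> idems S" "e' \<in> idems S" "f \<in> idems S" "left_ideal S e = left_ideal S e'"
    "u \<in> corner S e f"
  shows "rho S e u f = rho S e' (e' \<odot> u) f" and "e' \<odot> u \<in> corner S e' f"
proof -
  note c = idemsD[OF assms(1)] idemsD[OF assms(2)] idemsD[OF assms(3)]
    assms(5)[unfolded corner_iff[OF assms(1,3)]]
  show "e' \<odot> u \<in> corner S e' f"
    using c by (simp add: corner_iff assms closed assoc) (metis assoc)
  have "x \<odot> u = x \<odot> (e' \<odot> u)" if "x \<in> left_ideal S e'" for x
    using c that by (simp add: left_ideal_iff assms closed assoc[symmetric])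
  then show "rho S e u f = rho S e' (e' \<odot> u) f"
    using assms(4) by (auto simp: rho_def intro!: restrict_ext)
qed

lemma Hom_L_cat:
  assumes "e \<in> idems S" "f \<in> idems S"
  shows "Hom (L_cat S) (left_ideal S e) (left_ideal S f) = (\<lambda>u. rho S e u f) ` corner S e f"
proof (intro set_eqI iffI)
  fix m assume m: "m \<in> Hom (L_cat S) (left_ideal S e) (left_ideal S f)"
  then obtain e' u f' where 1: "m = rho S e' u f'" "e' \<in> idems S" "f' \<in> idems S"
    "u \<in> corner S e' f'" "left_ideal S e' = left_ideal S e" "left_ideal S f' = left_ideal S f"
    by (auto simp: L_cat_def Hom_def rho_def)
  \<comment> \<open>A morphism comes with its own idempotents \<open>e'\<close>, \<open>f'\<close>.
    Equality of the codomains makes \<open>u\<close> fixed by \<open>f\<close> as well; the domain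
    is then adjusted by \<open>rho_change_idem\<close>.\<close>
  have "f' \<odot> f = f'"
    using left_ideal_subset_iff[of f' f] 1 assms by auto
  then have "u \<in> corner S e' f"
    using 1 assms assoc[of u f' f] by (auto simp: corner_iff idemsD)
  moreover have "m = rho S e' u f"
    using 1 by (simp add: rho_def)
  ultimately show "m \<in> (\<lambda>u. rho S e u f) ` corner S e f"
    using rho_change_idem[of e' e f u] 1 assms by auto
next
  fix m assume "m \<in> (\<lambda>u. rho S e u f) ` corner S e f"
  then show "m \<in> Hom (L_cat S) (left_ideal S e) (left_ideal S f)"
    using assms by (auto simp: Hom_def) (auto simp: L_cat_def)
qed

lemma Hom_L_catE:
  assumes "m \<in> Hom (L_cat S) A B" "A = left_ideal S e" "B = left_ideal S f"
    "e \<in> idems S" "f \<in> idems S"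
  obtains u where "u \<in> corner S e f" "m = rho S e u f"
  using assms Hom_L_cat by auto

lemma Incl_L_catE:
  assumes "j \<in> Incl (L_cat S)" "Dom (L_cat S) j = left_ideal S e" "Cod (L_cat S) j = left_ideal S f"
    "e \<in> idems S" "f \<in> idems S"
  shows "j = rho S e e f" "e \<odot> f = e" "e \<in> corner S e f"
proof -
  obtain e' f' where "j = rho S e' e' f'" "e' \<in> idems S" "left_ideal S e' \<subseteq> left_ideal S f'"
    using assms by (auto simp: L_cat_def)
  then show 1: "j = rho S e e f" "e \<odot> f = e"
    using assms(2-) by (auto simp: L_cat_def rho_incl left_ideal_subset_iff[symmetric])
  then show "e \<in> corner S e f"
    using assms by (simp add: corner_iff idemsD)
qed

lemma MorE:
  assumes "m \<in> Mor (L_cat S)"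
  obtains e f u where "e \<in> idems S" "f \<in> idems S" "u \<in> corner S e f" "m = rho S e u f"
  using assms by (auto simp: L_cat_def)

lemma Incl_L_cat_Mor: "Incl (L_cat S) \<subseteq> Mor (L_cat S)"
proof
  fix j assume "j \<in> Incl (L_cat S)"
  then obtain e f where "j = rho S e e f" "e \<in> idems S" "f \<in> idems S"
    "left_ideal S e \<subseteq> left_ideal S f"
    by (auto simp: L_cat_def)
  moreover from this have "e \<in> corner S e f"
    using left_ideal_subset_iff by (auto simp: corner_iff idemsD)
  ultimately show "j \<in> Mor (L_cat S)"
    by (auto simp: L_cat_def)
qed

end

lemma (in regular_semigroup) idems_nonempty: "idems S \<noteq> {}"
proof -
  obtain x where x: "x \<in> Car S"
    using nonempty by auto
  then obtain y where "y \<in> Car S" "x \<odot> y \<odot> x = x"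
    using regular by blast
  then have "x \<odot> y \<in> idems S"
    using x by (simp add: idems_def closed assoc[symmetric])
  then show ?thesis by auto
qed

lemma (in regular_semigroup) small_category_L_cat: "small_category (L_cat S)"
proof
  show "Obj (L_cat S) \<noteq> {}"
    using idems_nonempty by (auto simp: L_cat_def)
next
  fix m assume "m \<in> Mor (L_cat S)"
  then show "Dom (L_cat S) m \<in> Obj (L_cat S)" "Cod (L_cat S) m \<in> Obj (L_cat S)"
    by (auto simp: L_cat_def rho_def)
next
  fix A assume "A \<in> Obj (L_cat S)"
  then obtain e where "A = left_ideal S e" "e \<in> idems S"
    by (auto simp: L_cat_def)
  then show "Idt (L_cat S) A \<in> Hom (L_cat S) A A"
    using rho_Idt[of e] by (auto simp: Hom_L_cat)
next
  fix m A B assume m: "m \<in> Hom (L_cat S) A B"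
  then obtain e f where "A = left_ideal S e" "e \<in> idems S" "B = left_ideal S f" "f \<in> idems S"
    by (auto simp: Hom_def L_cat_def rho_def)
  with m obtain u where u: "u \<in> corner S e f" "m = rho S e u f" "A = left_ideal S e" "e \<in> idems S"
    "B = left_ideal S f" "f \<in> idems S"
    by (metis Hom_L_catE)
  then have u': "e \<odot> u = u" "u \<odot> f = u"
    by (auto simp: corner_iff)
  show "Idt (L_cat S) A \<cdot>\<^bsub>L_cat S\<^esub> m = m" "m \<cdot>\<^bsub>L_cat S\<^esub> Idt (L_cat S) B = m"
    using u rho_Idt[of e] rho_Idt[of f] rho_cmp[of e e f e u] rho_cmp[of e f f u f] u'
    by simp_all
next
  fix m n A B D assume m: "m \<in> Hom (L_cat S) A B" and n: "n \<in> Hom (L_cat S) B D"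
  obtain e f g where 0: "A = left_ideal S e" "e \<in> idems S" "B = left_ideal S f" "f \<in> idems S"
    "D = left_ideal S g" "g \<in> idems S"
    using m n by (auto simp: Hom_def L_cat_def rho_def)
  obtain u where "u \<in> corner S e f" "m = rho S e u f"
    using 0 m by (metis Hom_L_catE)
  moreover obtain v where "v \<in> corner S f g" "n = rho S f v g"
    using 0 n by (metis Hom_L_catE)
  ultimately show "m \<cdot>\<^bsub>L_cat S\<^esub> n \<in> Hom (L_cat S) A D"
    using 0 rho_cmp[of e f g u v] by (simp add: Hom_L_cat)
next
  fix m n k A B D E
  assume m: "m \<in> Hom (L_cat S) A B" and n: "n \<in> Hom (L_cat S) B D" and k: "k \<in> Hom (L_cat S) D E"
  obtain e f g h where 0: "A = left_ideal S e" "e \<in> idems S" "B = left_ideal S f" "f \<in> idems S"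
    "D = left_ideal S g" "g \<in> idems S" "E = left_ideal S h" "h \<in> idems S"
    using m n k by (auto simp: Hom_def L_cat_def rho_def)
  obtain u where u: "u \<in> corner S e f" "m = rho S e u f"
    using 0 m by (metis Hom_L_catE)
  obtain v where v: "v \<in> corner S f g" "n = rho S f v g"
    using 0 n by (metis Hom_L_catE)
  obtain w where w: "w \<in> corner S g h" "k = rho S g w h"
    using 0 k by (metis Hom_L_catE)
  have "(u \<odot> v) \<odot> w = u \<odot> (v \<odot> w)"
    using 0 u v w by (auto simp: corner_iff assoc)
  then show "m \<cdot>\<^bsub>L_cat S\<^esub> n \<cdot>\<^bsub>L_cat S\<^esub> k = m \<cdot>\<^bsub>L_cat S\<^esub> (n \<cdot>\<^bsub>L_cat S\<^esub> k)"
    using 0 u v w rho_cmp[of e f g u v] rho_cmp[of f g h v w] rho_cmp[of e g h "u \<odot> v" w]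
      rho_cmp[of e f h u "v \<odot> w"]
    by simp
qed

section \<open>The axioms of unambiguity for \<open>L_cat S\<close>\<close>

context locally_inverse_semigroup
begin

lemma local_inverse_unique:
  assumes "e \<in> idems S" "x \<in> corner S e e" "y \<in> corner S e e" "z \<in> corner S e e"
    "x \<odot> y \<odot> x = x" "y \<odot> x \<odot> y = y" "x \<odot> z \<odot> x = x" "z \<odot> x \<odot> z = z"
  shows "y = z"
  using inverse_semigroup.unique_inverse[OF locally_inverse[OF assms(1)], of x] assms(2-) by auto

text \<open>Retractions for \<open>Se \<subseteq> Sf\<close> correspond to elements \<open>v\<close>
  of \<open>fSe\<close> with \<open>e v = e\<close>, and \<open>f e\<close> is one. Two such
  elements \<open>v\<close>, \<open>w\<close> are idempotents with \<open>v w = v\<close> and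
  \<open>w v = w\<close>, so both are inverses of \<open>v\<close> in \<open>fSf\<close>.\<close>

lemma incl_L_cat_splits_uniquely:
  assumes "j \<in> Incl (L_cat S)"
  shows "\<exists>!r. splits_by (L_cat S) j r"
proof -
  obtain e f where ef: "e \<in> idems S" "f \<in> idems S" and je: "j = rho S e e f"
    using assms by (auto simp: L_cat_def)
  note e = Incl_L_catE[OF assms, of e f, unfolded je, simplified rho_Dom_Cod, OF refl refl ef]
  note c = idemsD[OF ef(1)] idemsD[OF ef(2)]
  have split: "splits_by (L_cat S) j r \<longleftrightarrow> (\<exists>v\<in>corner S f e. r = rho S f v e \<and> e \<odot> v = e)" for r
  proof -
    have "rho S e e f \<cdot>\<^bsub>L_cat S\<^esub> rho S f v e = Idt (L_cat S) (left_ideal S e) \<longleftrightarrow> e \<odot> v = e"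
      if "v \<in> corner S f e" for v
      using that rho_cmp[of e f e e v] rho_Idt[of e] ef e rho_eq_iff[of e e e "e \<odot> v" e]
      by simp
    then show ?thesis
      using assms je ef by (auto simp: splits_by_def Hom_L_cat)
  qed
  have fe: "f \<odot> e \<in> corner S f e" "e \<odot> (f \<odot> e) = e"
    using c e(2) by (simp_all add: corner_iff ef closed assoc[symmetric]) (simp_all add: assoc)
  have uniq: "v = w" if "v \<in> corner S f e" "w \<in> corner S f e" "e \<odot> v = e" "e \<odot> w = e" for v w
  proof -
    have vw: "v \<in> Car S" "f \<odot> v = v" "v \<odot> e = v" "w \<in> Car S" "f \<odot> w = w" "w \<odot> e = w"
      using that ef by (auto simp: corner_iff)
    \<comment> \<open>Since \<open>e f = e\<close>, being fixed by \<open>e\<close> on the right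
      implies being fixed by \<open>f\<close>.\<close>
    have ff: "v \<in> corner S f f" "w \<in> corner S f f"
      using vw c e(2) by (simp_all add: corner_iff ef) (metis assoc)+
    have "v \<odot> w = v" "w \<odot> v = w" "v \<odot> v = v" "w \<odot> w = w"
      using vw c that(3,4) by (metis assoc)+
    then show "v = w"
      using local_inverse_unique[of f v v w] ff ef by simp
  qed
  show ?thesis
    unfolding split using fe uniq by (intro ex1I[of _ "rho S f (f \<odot> e) e"]) auto
qed

text \<open>In any normal factorisation of \<open>rho S e u g\<close> the middle isomorphism is
  again multiplication by \<open>u\<close>. If \<open>w\<close> represents its inverse, the other
  two factors are given by the idempotents \<open>u w\<close> and \<open>w u\<close>.\<close>

lemma normal_factorisation_L_catE:
  assumes eg: "e \<in> idems S" "g \<in> idems S" "u \<in> corner S e g"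
    and "is_normal_factorisation (L_cat S) (rho S e u g) F"
  obtains v w h where "v \<in> idems S" "h \<in> idems S" "v \<in> corner S e e" "w \<in> Car S" "u \<odot> w = v" "w \<odot> u = h"
    "v \<odot> u = u" "u \<odot> h = u"
    "F = (rho S e v v, rho S v u h, rho S h h g)"
proof -
  let ?L = "L_cat S"
  interpret L: small_category ?L by (rule small_category_L_cat)
  obtain r s j where F: "F = (r, s, j)"
    by (cases F)
  have nf: "is_retraction ?L r" "is_iso ?L s" "j \<in> Incl ?L" "Cod ?L r = Dom ?L s"
    "Cod ?L s = Dom ?L j" "rho S e u g = r \<cdot>\<^bsub>?L\<^esub> s \<cdot>\<^bsub>?L\<^esub> j"
    using assms(4) unfolding F by simp_all
  obtain i where i: "i \<in> Incl ?L" "r \<in> Hom ?L (Cod ?L i) (Dom ?L i)"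
      "i \<cdot>\<^bsub>?L\<^esub> r = Idt ?L (Dom ?L i)"
    using nf(1) unfolding is_retraction_def splits_by_def by blast
  have sM: "s \<in> Mor ?L" "r \<in> Mor ?L" "j \<in> Mor ?L"
    using nf i Incl_L_cat_Mor by (auto simp: is_iso_def Hom_def)
  have rH: "r \<in> Hom ?L (Dom ?L r) (Dom ?L s)" "s \<in> Hom ?L (Dom ?L s) (Dom ?L j)"
    "j \<in> Hom ?L (Dom ?L j) (Cod ?L j)"
    using sM nf by (auto simp: Hom_def)
  have "rho S e u g \<in> Hom ?L (Dom ?L r) (Cod ?L j)"
    using L.cmp_Hom[OF L.cmp_Hom[OF rH(1,2)] rH(3)] nf(6) by simp
  then have dr: "Dom ?L r = left_ideal S e" and cj: "Cod ?L j = left_ideal S g"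
    by (simp_all add: Hom_def)
  obtain a where a: "a \<in> idems S" "Cod ?L r = left_ideal S a"
    using L.Cod_Obj[OF sM(2)] by (auto simp: L_cat_def)
  obtain b where b: "b \<in> idems S" "Dom ?L j = left_ideal S b"
    using L.Dom_Obj[OF sM(3)] by (auto simp: L_cat_def)
  have di: "Dom ?L i = left_ideal S a" "Cod ?L i = left_ideal S e"
    using i(2) a dr by (auto simp: Hom_def)
  note ia = Incl_L_catE[OF i(1) di a(1) eg(1)]
  obtain v where v: "v \<in> corner S e a" "r = rho S e v a"
    using Hom_L_catE[OF i(2) di(2,1) eg(1) a(1)] by blast
  note c = idemsD[OF eg(1)] idemsD[OF a(1)] idemsD[OF b(1)]
  have v': "v \<in> Car S" "e \<odot> v = v" "v \<odot> a = v"
    using v eg a by (auto simp: corner_iff)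
  have av: "a \<odot> v = a"
    using i(3) di rho_Idt[OF a(1)] rho_cmp[OF a(1) eg(1) a(1) ia(3) v(1)]
      rho_eq_iff[of a a a "a \<odot> v" a] a by (simp add: ia(1) v(2))
  have "v \<odot> v = v"
    using v' av c by (metis assoc)
  then have vi: "v \<in> idems S"
    using v' by (simp add: idems_def)
  \<comment> \<open>So the idempotent \<open>v\<close> can replace \<open>a\<close> as the generator
    of the codomain of the retraction.\<close>
  have va: "left_ideal S v = left_ideal S a"
    using av v' vi a by (simp add: set_eq_subset left_ideal_subset_iff)
  have vc: "v \<in> corner S e e"
    using v' ia c eg by (simp add: corner_iff) (metis assoc)
  have r: "r = rho S e v v"
    using v(2) va by (simp add: rho_def)
  obtain t where t: "t \<in> Hom ?L (Cod ?L s) (Dom ?L s)" "s \<cdot>\<^bsub>?L\<^esub> t = Idt ?L (Dom ?L s)"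
      "t \<cdot>\<^bsub>?L\<^esub> s = Idt ?L (Cod ?L s)"
    using nf(2) unfolding is_iso_def by blast
  have ds: "Dom ?L s = left_ideal S v" "Cod ?L s = left_ideal S b"
    using nf a b va by (auto)
  obtain u' where u': "u' \<in> corner S v b" "s = rho S v u' b"
    using Hom_L_catE[OF rH(2) ds(1) b(2) vi b(1)] by blast
  obtain w where w: "w \<in> corner S b v" "t = rho S b w v"
    using Hom_L_catE[OF t(1) ds(2) ds(1) b(1) vi] by blast
  have uw: "u' \<odot> w = v"
    using t(2) ds rho_Idt[OF vi] rho_cmp[OF vi b(1) vi u'(1) w(1)] rho_eq_iff[of v v v "u' \<odot> w" v] vi
    by (simp add: w u')
  have wu: "w \<odot> u' = b"
    using t(3) ds rho_Idt[OF b(1)] rho_cmp[OF b(1) vi b(1) w(1) u'(1)] rho_eq_iff[of b b b "w \<odot> u'" b] b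
    by (simp add: w u')
  note jb = Incl_L_catE[OF nf(3) b(2) cj b(1) eg(2)]
  have u'c: "u' \<in> Car S" "v \<odot> u' = u'" "u' \<odot> b = u'"
    using u' vi b by (auto simp: corner_iff)
  have vcv: "v \<in> corner S e v"
    using vc vi eg by (simp add: corner_iff idemsD)
  have "rho S e u g = rho S e u' g" "u' \<in> corner S e g"
    using nf(6) rho_cmp[OF eg(1) vi b(1) vcv u'(1)] u'c
      rho_cmp[OF eg(1) b(1) eg(2) _ jb(3), of u'] by (simp_all add: r u' jb(1))
  then have "u = u'"
    using rho_eq_iff eg by blast
  then show thesis
    using that[of v b w] vi b(1) vc w uw wu u'c F r u'(2) jb(1) by (auto simp: corner_iff)
qed

text \<open>If \<open>u y u = u\<close>, then \<open>y u y\<close> is an inverse of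
  \<open>u\<close>, and \<open>w = g (y u y) e\<close> is one lying in \<open>gSe\<close>. The
  idempotents \<open>u w\<close> and \<open>w u\<close> generate the ideals between which
  \<open>u\<close> acts as an isomorphism.\<close>

lemma normal_factorisation_L_cat_ex:
  assumes eg: "e \<in> idems S" "g \<in> idems S" "u \<in> corner S e g"
  shows "\<exists>F. is_normal_factorisation (L_cat S) (rho S e u g) F"
proof -
  let ?L = "L_cat S"
  note c = idemsD[OF eg(1)] idemsD[OF eg(2)]
  have u: "u \<in> Car S" "e \<odot> u = u" "u \<odot> g = u"
    using eg by (auto simp: corner_iff)
  obtain y where y: "y \<in> Car S" "u \<odot> y \<odot> u = u"
    using regular u by blast
  define w where "w = g \<odot> (y \<odot> u \<odot> y) \<odot> e"
  have w: "w \<in> Car S" "g \<odot> w = w" "w \<odot> e = w"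
    using c y u unfolding w_def
    by (simp_all add: closed assoc) (simp_all add: closed assoc[symmetric])
  have eu: "e \<odot> (u \<odot> z) = u \<odot> z" and ug: "u \<odot> (g \<odot> z) = u \<odot> z"
    and yu: "u \<odot> (y \<odot> (u \<odot> z)) = u \<odot> z" if "z \<in> Car S" for z
    using that u c y by (metis assoc closed)+
  have uwu: "u \<odot> w \<odot> u = u" and wuw: "w \<odot> u \<odot> w = w"
    using c y u unfolding w_def by (simp_all add: closed assoc eu ug yu)
  define a where "a = u \<odot> w"
  define b where "b = w \<odot> u"
  have wu': "w \<odot> (u \<odot> w) = w" "u \<odot> (w \<odot> u) = u"
    using uwu wuw u w by (simp_all add: assoc)
  have wu'': "w \<odot> (u \<odot> (w \<odot> u)) = w \<odot> u" "u \<odot> (w \<odot> (u \<odot> w)) = u \<odot> w"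
    "g \<odot> (w \<odot> u) = w \<odot> u"
    using wu' w u c by (simp_all add: assoc[symmetric])
  have we: "u \<odot> (w \<odot> e) = u \<odot> w" "w \<odot> (u \<odot> g) = w \<odot> u"
    using u w by simp_all
  have ab: "a \<in> idems S" "b \<in> idems S" "e \<odot> a = a" "a \<odot> e = a" "g \<odot> b = b" "b \<odot> g = b"
    "a \<odot> u = u" "u \<odot> b = u" "b \<odot> w = w" "w \<odot> a = w" "a \<odot> a = a" "b \<odot> b = b"
    using u w c uwu wuw we unfolding a_def b_def idems_def
    by (simp_all add: closed assoc wu' eu wu'')
  have C: "a \<in> corner S e a" "a \<in> corner S a e" "u \<in> corner S a b" "w \<in> corner S b a" "b \<in> corner S b g"
    using ab u w eg by (auto simp: corner_iff idemsD)
  have 1: "splits_by ?L (rho S a a e) (rho S e a a)"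
    using C ab eg rho_cmp[of a e a a a] rho_Idt[of a] left_ideal_subset_iff[of a e]
    by (auto simp: splits_by_def Hom_L_cat) (auto simp: L_cat_def)
  have 2: "is_iso ?L (rho S a u b)"
    unfolding is_iso_def
  proof (intro conjI bexI[of _ "rho S b w a"])
    show "rho S a u b \<in> Mor ?L"
      using C ab by (auto simp: L_cat_def)
    show "rho S a u b \<cdot>\<^bsub>?L\<^esub> rho S b w a = Idt ?L (Dom ?L (rho S a u b))"
      using rho_cmp[of a b a u w] C ab rho_Idt[of a] by (simp add: a_def)
    show "rho S b w a \<cdot>\<^bsub>?L\<^esub> rho S a u b = Idt ?L (Cod ?L (rho S a u b))"
      using rho_cmp[of b a b w u] C ab rho_Idt[of b] by (simp add: b_def)
    show "rho S b w a \<in> Hom ?L (Cod ?L (rho S a u b)) (Dom ?L (rho S a u b))"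
      using C ab by (simp add: Hom_L_cat)
  qed
  have 3: "rho S b b g \<in> Incl ?L"
    using left_ideal_subset_iff[of b g] ab eg by (auto simp: L_cat_def)
  have "rho S e u g = rho S e a a \<cdot>\<^bsub>?L\<^esub> rho S a u b \<cdot>\<^bsub>?L\<^esub> rho S b b g"
    using rho_cmp[of e a b a u] rho_cmp[of e b g u b] C ab eg by simp
  then have "is_normal_factorisation ?L (rho S e u g) (rho S e a a, rho S a u b, rho S b b g)"
    using 1 2 3 unfolding is_normal_factorisation.simps is_retraction_def rho_Dom_Cod by blast
  then show ?thesis by blast
qed

lemma unique_normal_factorisation_L_cat:
  assumes "m \<in> Mor (L_cat S)"
  shows "\<exists>!F. is_normal_factorisation (L_cat S) m F"
proof -
  obtain e g u where eg: "e \<in> idems S" "g \<in> idems S" "u \<in> corner S e g" and m: "m = rho S e u g"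
    using MorE[OF assms] by blast
  have u: "u \<in> Car S"
    using eg by (simp add: corner_iff)
  have "F = F'" if F: "is_normal_factorisation (L_cat S) m F" and F': "is_normal_factorisation (L_cat S) m F'"
    for F F'
  proof -
    obtain v w h where 1: "v \<in> idems S" "h \<in> idems S" "v \<in> corner S e e" "w \<in> Car S"
        "u \<odot> w = v" "w \<odot> u = h" "v \<odot> u = u" "u \<odot> h = u"
        "F = (rho S e v v, rho S v u h, rho S h h g)"
      using normal_factorisation_L_catE[OF eg F[unfolded m]] by blast
    obtain v' w' h' where 2: "v' \<in> idems S" "h' \<in> idems S" "v' \<in> corner S e e" "w' \<in> Car S"
        "u \<odot> w' = v'" "w' \<odot> u = h'" "v' \<odot> u = u" "u \<odot> h' = u"
        "F' = (rho S e v' v', rho S v' u h', rho S h' h' g)"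
      using normal_factorisation_L_catE[OF eg F'[unfolded m]] by blast
    note c = idemsD[OF 1(1)] idemsD[OF 1(2)] idemsD[OF 2(1)] idemsD[OF 2(2)]
    \<comment> \<open>\<open>v v' = (v u) w' = u w' = v'\<close>, and symmetrically. Thus
      \<open>v\<close> and \<open>v'\<close> are both inverses of \<open>v\<close> in
      \<open>eSe\<close>.\<close>
    have "v \<odot> v' = v'" "v' \<odot> v = v"
      using 1 2 u c by (metis assoc)+
    then have v: "v = v'"
      using local_inverse_unique[of e v v v'] 1(3) 2(3) c eg by simp
    \<comment> \<open>Here only \<open>Sh = Sh'\<close> is derived, which suffices: the
      factorisation involves \<open>h\<close> only through its left ideal.\<close>
    have "h \<odot> h' = h" "h' \<odot> h = h'"
      using 1 2 u c by (metis assoc)+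
    then have "left_ideal S h = left_ideal S h'"
      using 1(2) 2(2) by (simp add: set_eq_subset left_ideal_subset_iff)
    moreover from this have "rho S h h g = rho S h' h' g"
      using 1(2) 2(2) by (simp add: rho_incl)
    ultimately show "F = F'"
      using 1(9) 2(9) v by (simp add: rho_def)
  qed
  moreover obtain F where "is_normal_factorisation (L_cat S) m F"
    using normal_factorisation_L_cat_ex[OF eg] m by blast
  ultimately show ?thesis by blast
qed

text \<open>The cone is right multiplication by \<open>e\<close> on every left ideal. One formula
  for all components gives compatibility with inclusions, and on \<open>Se\<close> it is the
  identity.\<close>

lemma normal_cone_L_cat_at:
  assumes "A \<in> Obj (L_cat S)"
  shows "\<exists>B \<mu>. is_normal_cone (L_cat S) B \<mu> \<and> \<mu> A = Idt (L_cat S) A"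
proof -
  let ?L = "L_cat S"
  interpret L: small_category ?L by (rule small_category_L_cat)
  obtain e where e: "e \<in> idems S" "A = left_ideal S e"
    using assms by (auto simp: L_cat_def)
  define \<mu> where "\<mu> = (\<lambda>B. (B, (\<lambda>x\<in>B. x \<odot> e), A))"
  have 1: "\<mu> B \<in> Hom ?L B A" if "B \<in> Obj ?L" for B
  proof -
    obtain f where f: "f \<in> idems S" "B = left_ideal S f"
      using \<open>B \<in> Obj ?L\<close> by (auto simp: L_cat_def)
    have "f \<odot> e \<in> corner S f e"
      using idemsD[OF e(1)] idemsD[OF f(1)] e f by (simp add: corner_iff closed assoc) (metis assoc)
    moreover have "\<mu> B = rho S f (f \<odot> e) e"
      using idemsD[OF e(1)] idemsD[OF f(1)] e f
      by (auto simp: \<mu>_def rho_def left_ideal_iff assoc[symmetric] intro!: restrict_ext)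
    ultimately show ?thesis
      using e f by (simp add: Hom_L_cat)
  qed
  have 2: "j \<cdot>\<^bsub>?L\<^esub> \<mu> (Cod ?L j) = \<mu> (Dom ?L j)" if "j \<in> Incl ?L" for j
    using that by (auto simp: L_cat_def rho_incl \<mu>_def compose_def subset_iff intro!: restrict_ext)
  have 3: "\<mu> A = Idt ?L A"
    using e by (auto simp: L_cat_def \<mu>_def left_ideal_iff intro!: restrict_ext)
  have 4: "is_iso ?L (Idt ?L A)"
    using L.Idt_Hom[OF assms] L.cmp_Idt_left[of "Idt ?L A" A A]
    unfolding is_iso_def Hom_def by (intro conjI bexI[of _ "Idt ?L A"]) simp_all
  show ?thesis
    using 1 2 3 4 assms unfolding is_normal_cone_def by metis
qed

end

section \<open>Transport along functors\<close>

text \<open>Isomorphisms, splittings and normal factorisations are defined by equations, so a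
  functor preserving inclusions carries them along. It is instantiated with both functors of an
  isomorphism.\<close>

locale subobj_functor =
  src: small_category C
  for C :: "('o, 'm) subobj_category"
  and D :: "('p, 'n) subobj_category" and F\<^sub>o :: "'o \<Rightarrow> 'p" and F\<^sub>m :: "'m \<Rightarrow> 'n" +
  assumes is_functor: "is_functor C D F\<^sub>o F\<^sub>m"
    and incl: "F\<^sub>m ` Incl C \<subseteq> Incl D"
    and Incl_Mor: "Incl C \<subseteq> Mor C"
begin

lemma functor_simps:
  "a \<in> Obj C \<Longrightarrow> F\<^sub>o a \<in> Obj D"
  "f \<in> Mor C \<Longrightarrow> F\<^sub>m f \<in> Mor D"
  "f \<in> Mor C \<Longrightarrow> Dom D (F\<^sub>m f) = F\<^sub>o (Dom C f)"
  "f \<in> Mor C \<Longrightarrow> Cod D (F\<^sub>m f) = F\<^sub>o (Cod C f)"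
  "a \<in> Obj C \<Longrightarrow> Idt D (F\<^sub>o a) = F\<^sub>m (Idt C a)"
  "\<lbrakk>f \<in> Mor C; g \<in> Mor C; Cod C f = Dom C g\<rbrakk> \<Longrightarrow> F\<^sub>m f \<cdot>\<^bsub>D\<^esub> F\<^sub>m g = F\<^sub>m (f \<cdot>\<^bsub>C\<^esub> g)"
  using is_functor unfolding is_functor_def by auto

lemma map_is_iso:
  assumes "is_iso C f"
  shows "is_iso D (F\<^sub>m f)"
proof -
  obtain g where "f \<in> Mor C" "g \<in> Mor C" "Dom C g = Cod C f" "Cod C g = Dom C f"
    "f \<cdot>\<^bsub>C\<^esub> g = Idt C (Dom C f)" "g \<cdot>\<^bsub>C\<^esub> f = Idt C (Cod C f)"
    using assms unfolding is_iso_def Hom_def by auto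
  then show ?thesis
    unfolding is_iso_def Hom_def
    by (auto simp: functor_simps src.Dom_Obj src.Cod_Obj intro!: exI[of _ "F\<^sub>m g"])
qed

lemma map_splits_by: "splits_by C j r \<Longrightarrow> splits_by D (F\<^sub>m j) (F\<^sub>m r)"
  using incl Incl_Mor unfolding splits_by_def Hom_def
  by (auto simp: functor_simps src.Dom_Obj subset_iff)

lemma map_normal_factorisation:
  assumes "is_normal_factorisation C f (r, s, j)"
  shows "is_normal_factorisation D (F\<^sub>m f) (F\<^sub>m r, F\<^sub>m s, F\<^sub>m j)"
proof -
  have nf: "is_retraction C r" "is_iso C s" "j \<in> Incl C" "Cod C r = Dom C s" "Cod C s = Dom C j"
    "f = r \<cdot>\<^bsub>C\<^esub> s \<cdot>\<^bsub>C\<^esub> j"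
    using assms by simp_all
  have M: "r \<in> Mor C" "s \<in> Mor C" "j \<in> Mor C"
    using nf Incl_Mor by (auto simp: is_retraction_def splits_by_def is_iso_def Hom_def)
  then have "r \<cdot>\<^bsub>C\<^esub> s \<in> Hom C (Dom C r) (Cod C s)"
    using src.cmp_Hom[of r _ _ s] nf by (auto simp: Hom_def)
  then have "F\<^sub>m f = F\<^sub>m r \<cdot>\<^bsub>D\<^esub> F\<^sub>m s \<cdot>\<^bsub>D\<^esub> F\<^sub>m j"
    using M nf by (simp add: functor_simps Hom_def)
  moreover have "is_retraction D (F\<^sub>m r)"
    using nf(1) map_splits_by unfolding is_retraction_def by blast
  ultimately show ?thesis
    using nf M incl map_is_iso by (auto simp: functor_simps)
qed

end

text \<open>Existence is pulled back along \<open>G\<close>. For uniqueness, any solution in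
  \<open>C\<close> is sent by \<open>F\<close> to the only solution in \<open>L_cat S\<close>, and
  \<open>G\<close> undoes \<open>F\<close>.\<close>

theorem unambiguous_if_isomorphic_L_cat:
  fixes C :: "('o, 'm) subobj_category" and S :: "'s sgrp"
  assumes C: "category_with_subobjects C"
    and S: "locally_inverse_semigroup S"
    and iso: "subobj_isomorphic C (L_cat S)"
  shows "unambiguous_category C"
proof -
  let ?L = "L_cat S"
  interpret C: category_with_subobjects C by (rule C)
  interpret S: locally_inverse_semigroup S by (rule S)
  obtain F\<^sub>o F\<^sub>m G\<^sub>o G\<^sub>m where FG: "is_functor C ?L F\<^sub>o F\<^sub>m" "is_functor ?L C G\<^sub>o G\<^sub>m"
     "\<And>a. a \<in> Obj C \<Longrightarrow> G\<^sub>o (F\<^sub>o a) = a" "\<And>f. f \<in> Mor C \<Longrightarrow> G\<^sub>m (F\<^sub>m f) = f"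
     "\<And>b. b \<in> Obj ?L \<Longrightarrow> F\<^sub>o (G\<^sub>o b) = b" "\<And>g. g \<in> Mor ?L \<Longrightarrow> F\<^sub>m (G\<^sub>m g) = g"
     "F\<^sub>m ` Incl C \<subseteq> Incl ?L" "G\<^sub>m ` Incl ?L \<subseteq> Incl C"
    using iso unfolding subobj_isomorphic_def by (auto)
  interpret L: small_category ?L by (rule S.small_category_L_cat)
  interpret F: subobj_functor C ?L F\<^sub>o F\<^sub>m
    by unfold_locales (use FG C.Incl_Mor in auto)
  interpret G: subobj_functor ?L C G\<^sub>o G\<^sub>m
    by unfold_locales (use FG S.Incl_L_cat_Mor in auto)
  show ?thesis
  proof
    fix j assume j: "j \<in> Incl C"
    then have jL: "F\<^sub>m j \<in> Incl ?L" and jM: "j \<in> Mor C"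
      using FG C.Incl_Mor by (auto)
    obtain R where R: "splits_by ?L (F\<^sub>m j) R" "\<And>R'. splits_by ?L (F\<^sub>m j) R' \<Longrightarrow> R' = R"
      using S.incl_L_cat_splits_uniquely[OF jL] by blast
    show "\<exists>!r. splits_by C j r"
    proof (rule ex1I)
      show "splits_by C j (G\<^sub>m R)"
        using G.map_splits_by[OF R(1)] FG(4)[OF jM] by simp
      fix r assume r: "splits_by C j r"
      then have "F\<^sub>m r = R" "r \<in> Mor C"
        using R(2)[OF F.map_splits_by[OF r]] by (simp_all add: splits_by_def Hom_def)
      then show "r = G\<^sub>m R"
        using FG(4) by auto
    qed
  next
    fix f assume f: "f \<in> Mor C"
    then obtain N where N: "is_normal_factorisation ?L (F\<^sub>m f) N"
        "\<And>N'. is_normal_factorisation ?L (F\<^sub>m f) N' \<Longrightarrow> N' = N"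
      using S.unique_normal_factorisation_L_cat[OF F.functor_simps(2)[OF f]] by metis
    obtain R T J where RTJ: "N = (R, T, J)"
      by (cases N)
    show "\<exists>!F. is_normal_factorisation C f F"
    proof (rule ex1I)
      show "is_normal_factorisation C f (G\<^sub>m R, G\<^sub>m T, G\<^sub>m J)"
        using G.map_normal_factorisation[OF N(1)[unfolded RTJ]] FG(4)[OF f] by simp
      fix M assume M: "is_normal_factorisation C f M"
      obtain r t j where rtj: "M = (r, t, j)"
        by (cases M)
      have "(F\<^sub>m r, F\<^sub>m t, F\<^sub>m j) = N"
        using N(2) F.map_normal_factorisation M unfolding rtj by blast
      moreover have "r \<in> Mor C" "t \<in> Mor C" "j \<in> Mor C"
        using M C.Incl_Mor unfolding rtj
        by (auto simp: is_retraction_def splits_by_def is_iso_def Hom_def)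
      ultimately show "M = (G\<^sub>m R, G\<^sub>m T, G\<^sub>m J)"
        using FG(4) RTJ rtj by auto
    qed
  next
    fix c assume c: "c \<in> Obj C"
    obtain B \<mu> where \<mu>: "is_normal_cone ?L B \<mu>" "\<mu> (F\<^sub>o c) = Idt ?L (F\<^sub>o c)"
      using S.normal_cone_L_cat_at[OF F.functor_simps(1)[OF c]] by blast
    have H: "\<mu> A \<in> Mor ?L" "Dom ?L (\<mu> A) = A" "Cod ?L (\<mu> A) = B" if "A \<in> Obj ?L" for A
      using \<mu>(1) that by (auto simp: is_normal_cone_def Hom_def)
    have "is_normal_cone C (G\<^sub>o B) (\<lambda>a. G\<^sub>m (\<mu> (F\<^sub>o a)))"
      unfolding is_normal_cone_def
    proof (intro conjI ballI)
      show "G\<^sub>o B \<in> Obj C"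
        using \<mu> G.functor_simps(1) by (auto simp: is_normal_cone_def)
      show "G\<^sub>m (\<mu> (F\<^sub>o a)) \<in> Hom C a (G\<^sub>o B)" if "a \<in> Obj C" for a
        using H[OF F.functor_simps(1)[OF that]] FG(3)[OF that]
        by (simp add: Hom_def G.functor_simps)
      show "j \<cdot>\<^bsub>C\<^esub> G\<^sub>m (\<mu> (F\<^sub>o (Cod C j))) = G\<^sub>m (\<mu> (F\<^sub>o (Dom C j)))" if j: "j \<in> Incl C" for j
      proof -
        have jL: "F\<^sub>m j \<in> Incl ?L" and jM: "j \<in> Mor C"
          using FG C.Incl_Mor j by (auto)
        have "F\<^sub>m j \<cdot>\<^bsub>?L\<^esub> \<mu> (F\<^sub>o (Cod C j)) = \<mu> (F\<^sub>o (Dom C j))"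
          using \<mu>(1) jL jM by (metis F.functor_simps(3,4) is_normal_cone_def)
        then show ?thesis
          using G.functor_simps(6)[of "F\<^sub>m j" "\<mu> (F\<^sub>o (Cod C j))"] jM FG(4)[OF jM] H
          by (simp add: F.functor_simps C.Cod_Obj)
      qed
      obtain A where A: "A \<in> Obj ?L" "is_iso ?L (\<mu> A)"
        using \<mu>(1) by (auto simp: is_normal_cone_def)
      then show "\<exists>a\<in>Obj C. is_iso C (G\<^sub>m (\<mu> (F\<^sub>o a)))"
        using G.map_is_iso G.functor_simps(1) FG(5) by (intro bexI[of _ "G\<^sub>o A"]) simp_all
    qed
    moreover have "G\<^sub>m (\<mu> (F\<^sub>o c)) = Idt C c"
      using \<mu>(2) G.functor_simps(5)[of "F\<^sub>o c"] F.functor_simps(1) c FG(3) by simp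
    ultimately show "\<exists>d \<mu>. is_normal_cone C d \<mu> \<and> \<mu> c = Idt C c"
      by blast
  qed
qed

section \<open>Epimorphic components in unambiguous categories\<close>

context small_category
begin

lemma cmp_Mor [simp]:
  assumes "f \<in> Mor C" "g \<in> Mor C" "Cod C f = Dom C g"
  shows "f \<cdot> g \<in> Mor C" "Dom C (f \<cdot> g) = Dom C f" "Cod C (f \<cdot> g) = Cod C g"
  using cmp_Hom[of f "Dom C f" "Cod C f" g "Cod C g"] assms by (auto simp: Hom_def)

lemma Idt_Mor [simp]:
  assumes "a \<in> Obj C"
  shows "Idt C a \<in> Mor C" "Dom C (Idt C a) = a" "Cod C (Idt C a) = a"
  using Idt_Hom[OF assms] by (auto simp: Hom_def)

lemma Idt_cmp [simp]:
  assumes "f \<in> Mor C"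
  shows "Dom C f = a \<Longrightarrow> Idt C a \<cdot> f = f" "Cod C f = b \<Longrightarrow> f \<cdot> Idt C b = f"
  using cmp_Idt_left[of f] cmp_Idt_right[of f] assms by (auto simp: Hom_def)

lemma cmp_assoc_Mor:
  assumes "f \<in> Mor C" "g \<in> Mor C" "h \<in> Mor C" "Cod C f = Dom C g" "Cod C g = Dom C h"
  shows "(f \<cdot> g) \<cdot> h = f \<cdot> (g \<cdot> h)"
  using cmp_assoc[of f _ _ g _ h] assms by (auto simp: Hom_def)

declare Dom_Obj [simp] Cod_Obj [simp]

text \<open>Since composition runs from left to right, the section \<open>x\<close> stands before
  \<open>e\<close>, and split epimorphisms cancel on the left.\<close>

definition split_epi :: "'m \<Rightarrow> bool" where
  "split_epi e \<longleftrightarrow> e \<in> Mor C \<and>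
     (\<exists>x\<in>Mor C. Dom C x = Cod C e \<and> Cod C x = Dom C e \<and> x \<cdot> e = Idt C (Cod C e))"

lemma split_epiE:
  assumes "split_epi e"
  obtains x where "x \<in> Mor C" "Dom C x = Cod C e" "Cod C x = Dom C e" "x \<cdot> e = Idt C (Cod C e)"
  using assms by (auto simp: split_epi_def)

lemma split_epiI:
  assumes "e \<in> Mor C" "x \<in> Mor C" "Dom C x = Cod C e" "Cod C x = Dom C e" "x \<cdot> e = Idt C (Cod C e)"
  shows "split_epi e"
  using assms by (auto simp: split_epi_def)

lemma split_epi_Mor [simp]: "split_epi e \<Longrightarrow> e \<in> Mor C"
  by (simp add: split_epi_def)

lemma split_epi_cancel:
  assumes "split_epi e" "f \<in> Mor C" "g \<in> Mor C" "Dom C f = Cod C e" "Dom C g = Cod C e"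
    "e \<cdot> f = e \<cdot> g"
  shows "f = g"
proof -
  obtain x where x: "x \<in> Mor C" "Dom C x = Cod C e" "Cod C x = Dom C e" "x \<cdot> e = Idt C (Cod C e)"
    using assms(1) by (rule split_epiE)
  then show ?thesis
    using assms cmp_assoc_Mor[of x e f] cmp_assoc_Mor[of x e g] by simp
qed

lemma is_isoE:
  assumes "is_iso C f"
  obtains g where "f \<in> Mor C" "g \<in> Mor C" "Dom C g = Cod C f" "Cod C g = Dom C f"
    "f \<cdot> g = Idt C (Dom C f)" "g \<cdot> f = Idt C (Cod C f)"
  using assms unfolding is_iso_def Hom_def by auto

lemma is_isoI:
  assumes "f \<in> Mor C" "g \<in> Mor C" "Dom C g = Cod C f" "Cod C g = Dom C f"
    "f \<cdot> g = Idt C (Dom C f)" "g \<cdot> f = Idt C (Cod C f)"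
  shows "is_iso C f"
  using assms unfolding is_iso_def Hom_def by auto

lemma is_iso_Mor: "is_iso C f \<Longrightarrow> f \<in> Mor C"
  by (simp add: is_iso_def)

lemma is_iso_Idt: "a \<in> Obj C \<Longrightarrow> is_iso C (Idt C a)"
  by (rule is_isoI[of _ "Idt C a"]) auto

lemma is_iso_split_epi: "is_iso C f \<Longrightarrow> split_epi f"
  by (erule is_isoE) (rule split_epiI)

lemma split_epi_Idt: "a \<in> Obj C \<Longrightarrow> split_epi (Idt C a)"
  by (simp add: is_iso_Idt is_iso_split_epi)

lemma split_epi_cmp:
  assumes "split_epi e" "split_epi f" "Cod C e = Dom C f"
  shows "split_epi (e \<cdot> f)"
proof -
  obtain x where x: "x \<in> Mor C" "Dom C x = Cod C e" "Cod C x = Dom C e" "x \<cdot> e = Idt C (Cod C e)"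
    using assms(1) by (rule split_epiE)
  obtain y where y: "y \<in> Mor C" "Dom C y = Cod C f" "Cod C y = Dom C f" "y \<cdot> f = Idt C (Cod C f)"
    using assms(2) by (rule split_epiE)
  have "(y \<cdot> x) \<cdot> (e \<cdot> f) = y \<cdot> ((x \<cdot> e) \<cdot> f)"
    using x(1-3) y assms by (simp add: cmp_assoc_Mor)
  also have "\<dots> = Idt C (Cod C f)"
    using x(4) y assms by simp
  finally show ?thesis
    using x y assms by (intro split_epiI[of _ "y \<cdot> x"]) auto
qed

text \<open>From \<open>f (g f) = f\<close> the split epimorphism \<open>f\<close> cancels, so the
  one-sided inverse is two-sided.\<close>

lemma is_iso_if_inverses:
  assumes "split_epi f" "g \<in> Mor C" "Dom C g = Cod C f" "Cod C g = Dom C f" "f \<cdot> g = Idt C (Dom C f)"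
  shows "is_iso C f"
proof -
  have "f \<cdot> (g \<cdot> f) = f \<cdot> Idt C (Cod C f)"
    using assms cmp_assoc_Mor[of f g f] by simp
  then have "g \<cdot> f = Idt C (Cod C f)"
    using split_epi_cancel[of f "g \<cdot> f" "Idt C (Cod C f)"] assms by simp
  then show ?thesis
    using assms by (intro is_isoI[of f g]) auto
qed

end

section \<open>Inclusions as a partial order on objects\<close>

context category_with_subobjects
begin

lemma Incl_in_Mor [simp]: "j \<in> Incl C \<Longrightarrow> j \<in> Mor C"
  using Incl_Mor by auto

lemma Idt_Incl [simp]: "a \<in> Obj C \<Longrightarrow> Idt C a \<in> Incl C"
  using small_category.Idt_Hom[OF incl_subcategory, of a] by (simp add: incl_cat_def Hom_def)

lemma Incl_cmp: "\<lbrakk>j \<in> Incl C; k \<in> Incl C; Cod C j = Dom C k\<rbrakk> \<Longrightarrow> j \<cdot> k \<in> Incl C"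
  using small_category.cmp_Hom[OF incl_subcategory, of j "Dom C j" "Cod C j" k "Cod C k"]
  by (simp add: incl_cat_def Hom_def)

lemma Incl_eq: "\<lbrakk>j \<in> Incl C; k \<in> Incl C; Dom C j = Dom C k; Cod C j = Cod C k\<rbrakk> \<Longrightarrow> j = k"
  using Incl_preorder[of j "Dom C j" "Cod C j" k] by (simp add: incl_cat_def Hom_def)

lemma Incl_antisym:
  assumes "j \<in> Incl C" "k \<in> Incl C" "Cod C j = Dom C k" "Cod C k = Dom C j"
  shows "Cod C j = Dom C j" "Idt C (Dom C j) = j"
proof -
  have "j \<cdot> k = Idt C (Dom C j)" "k \<cdot> j = Idt C (Cod C j)"
    using assms by (auto intro!: Incl_eq Incl_cmp)
  then have "is_iso (incl_cat C) j"
    using assms by (auto simp: is_iso_def incl_cat_def Hom_def intro!: bexI[of _ k])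
  then obtain a where "a \<in> Obj C" "j = Idt C a"
    using Incl_strict by blast
  then show "Cod C j = Dom C j" "Idt C (Dom C j) = j"
    by auto
qed

text \<open>The identity \<open>g j\<close> is an inclusion, so its left factor \<open>g\<close> is
  one too, and antisymmetry makes \<open>j\<close> an identity.\<close>

lemma Incl_left_inverse:
  assumes "j \<in> Incl C" "g \<in> Mor C" "Dom C g = Cod C j" "Cod C g = Dom C j" "g \<cdot> j = Idt C (Cod C j)"
  shows "Cod C j = Dom C j" "Idt C (Dom C j) = j"
proof -
  have "g \<in> Incl C"
    by (rule Incl_factor[of "Idt C (Cod C j)" j g]) (simp_all add: assms)
  then show "Cod C j = Dom C j" "Idt C (Dom C j) = j"
    using Incl_antisym[OF assms(1) _ assms(3)[symmetric] assms(4)] by blast+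
qed

lemma Incl_cancel:
  assumes "j \<in> Incl C" "f \<in> Mor C" "g \<in> Mor C" "Cod C f = Dom C j" "Cod C g = Dom C j" "Dom C f = Dom C g"
    "f \<cdot> j = g \<cdot> j"
  shows "f = g"
proof -
  have "f \<in> Hom C (Dom C f) (Dom C j)" "g \<in> Hom C (Dom C f) (Dom C j)" "Dom C f \<in> Obj C"
    using assms by (simp_all add: Hom_def)
  then show ?thesis
    using Incl_mono[OF assms(1)] assms(7) unfolding is_mono_def by blast
qed

lemma is_retractionE:
  assumes "is_retraction C r"
  obtains j where "r \<in> Mor C" "j \<in> Incl C" "Dom C j = Cod C r" "Cod C j = Dom C r" "j \<cdot> r = Idt C (Cod C r)"
  using assms unfolding is_retraction_def splits_by_def Hom_def by auto

lemma is_retractionI: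
  assumes "r \<in> Mor C" "j \<in> Incl C" "Dom C j = Cod C r" "Cod C j = Dom C r" "j \<cdot> r = Idt C (Cod C r)"
  shows "is_retraction C r"
  using assms unfolding is_retraction_def splits_by_def Hom_def by auto

lemma is_retraction_split_epi: "is_retraction C r \<Longrightarrow> split_epi r"
  by (erule is_retractionE) (rule split_epiI, auto)

definition sub :: "'o \<Rightarrow> 'o \<Rightarrow> bool"  (infix \<open>\<sqsubseteq>\<close> 50) where
  "a \<sqsubseteq> b \<longleftrightarrow> (\<exists>j\<in>Incl C. Dom C j = a \<and> Cod C j = b)"

text \<open>At most one inclusion joins two objects, so the choice is forced when
  \<open>a \<sqsubseteq> b\<close>; otherwise the value is arbitrary.\<close>

definition inc :: "'o \<Rightarrow> 'o \<Rightarrow> 'm" where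
  "inc a b = (SOME j. j \<in> Incl C \<and> Dom C j = a \<and> Cod C j = b)"

lemma inc [simp]:
  assumes "a \<sqsubseteq> b"
  shows "inc a b \<in> Incl C" "Dom C (inc a b) = a" "Cod C (inc a b) = b"
proof -
  have "\<exists>j. j \<in> Incl C \<and> Dom C j = a \<and> Cod C j = b"
    using assms by (auto simp: sub_def)
  from someI_ex[OF this] show "inc a b \<in> Incl C" "Dom C (inc a b) = a" "Cod C (inc a b) = b"
    unfolding inc_def by blast+
qed

lemma inc_Mor [simp]: "a \<sqsubseteq> b \<Longrightarrow> inc a b \<in> Mor C"
  by simp

lemma sub_Incl: "j \<in> Incl C \<Longrightarrow> Dom C j \<sqsubseteq> Cod C j"
  by (auto simp: sub_def)

lemma inc_eq: "j \<in> Incl C \<Longrightarrow> inc (Dom C j) (Cod C j) = j"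
  by (rule Incl_eq) (simp_all add: sub_Incl)

lemma sub_refl [simp]: "a \<in> Obj C \<Longrightarrow> a \<sqsubseteq> a"
  using sub_Incl[of "Idt C a"] by simp

lemma inc_refl [simp]: "a \<in> Obj C \<Longrightarrow> inc a a = Idt C a"
  using inc_eq[of "Idt C a"] by simp

lemma sub_trans: "a \<sqsubseteq> b \<Longrightarrow> b \<sqsubseteq> c \<Longrightarrow> a \<sqsubseteq> c"
  using sub_Incl[of "inc a b \<cdot> inc b c"] by (simp add: Incl_cmp)

lemma sub_antisym: "a \<sqsubseteq> b \<Longrightarrow> b \<sqsubseteq> a \<Longrightarrow> a = b"
  using Incl_antisym[of "inc a b" "inc b a"] by simp

lemma inc_cmp [simp]: "a \<sqsubseteq> b \<Longrightarrow> b \<sqsubseteq> c \<Longrightarrow> inc a b \<cdot> inc b c = inc a c"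
  by (rule Incl_eq) (auto simp: Incl_cmp sub_trans[of a b c])

lemma sub_Obj: "a \<sqsubseteq> b \<Longrightarrow> a \<in> Obj C" "a \<sqsubseteq> b \<Longrightarrow> b \<in> Obj C"
  using Dom_Obj[of "inc a b"] Cod_Obj[of "inc a b"] by simp_all

end

section \<open>Consequences of unique normal factorisation\<close>

context unambiguous_category
begin

text \<open>If \<open>x e = 1\<close> and \<open>e = r s j\<close>, then \<open>x r s\<close> is a
  left inverse of the inclusion \<open>j\<close>, which must therefore be an identity.\<close>

lemma split_epi_factorisation:
  assumes "split_epi e"
  obtains r s where "is_normal_factorisation C e (r, s, Idt C (Cod C e))" "is_retraction C r"
    "is_iso C s" "Cod C r = Dom C s" "e = r \<cdot> s"
proof -
  obtain r s j where nf: "is_normal_factorisation C e (r, s, j)"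
    using unique_normal_factorisation[of e] assms by (metis prod_cases3 split_epi_Mor)
  then have 1: "is_retraction C r" "is_iso C s" "j \<in> Incl C" "Cod C r = Dom C s" "Cod C s = Dom C j"
    "e = r \<cdot> s \<cdot> j"
    by simp_all
  then have M: "r \<in> Mor C" "s \<in> Mor C" "j \<in> Mor C"
    by (auto simp: is_retraction_split_epi is_iso_Mor)
  obtain x where x: "x \<in> Mor C" "Dom C x = Cod C e" "Cod C x = Dom C e" "x \<cdot> e = Idt C (Cod C e)"
    using assms by (rule split_epiE)
  have ce: "Dom C e = Dom C r" "Cod C e = Cod C j"
    using M 1 by simp_all
  have "(x \<cdot> (r \<cdot> s)) \<cdot> j = x \<cdot> e"
    using 1 M x(1-3) ce by (simp add: cmp_assoc_Mor)
  then have j: "Cod C j = Dom C j" "Idt C (Dom C j) = j"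
    using Incl_left_inverse[of j "x \<cdot> (r \<cdot> s)"] 1 M x ce by simp_all
  then have "e = r \<cdot> s"
    using 1 M by (metis Idt_cmp(2) cmp_Mor(1,3))
  moreover have "j = Idt C (Cod C e)"
    using j ce by simp
  ultimately show thesis
    using that[of r s] nf 1(1,2,4) by blast
qed

text \<open>Existence groups the retraction and the isomorphism of a normal factorisation. For
  uniqueness, two competing split epimorphisms are each a retraction followed by an isomorphism,
  which produces two normal factorisations of \<open>f\<close>.\<close>

lemma epimorphic_component_ex1:
  assumes "f \<in> Mor C"
  shows "\<exists>!e. split_epi e \<and> (\<exists>j\<in>Incl C. Cod C e = Dom C j \<and> f = e \<cdot> j)"
proof (rule ex_ex1I)
  obtain r s j where nf: "is_normal_factorisation C f (r, s, j)"
    using unique_normal_factorisation[OF assms] by (metis prod_cases3)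
  then have "split_epi (r \<cdot> s)"
    by (simp add: split_epi_cmp is_retraction_split_epi is_iso_split_epi)
  moreover have "Cod C (r \<cdot> s) = Dom C j"
    using nf by (simp add: is_retraction_split_epi is_iso_Mor)
  ultimately show "\<exists>e. split_epi e \<and> (\<exists>j\<in>Incl C. Cod C e = Dom C j \<and> f = e \<cdot> j)"
    using nf by (intro exI[of _ "r \<cdot> s"]) auto
next
  fix e e' assume "split_epi e \<and> (\<exists>j\<in>Incl C. Cod C e = Dom C j \<and> f = e \<cdot> j)"
    and "split_epi e' \<and> (\<exists>j\<in>Incl C. Cod C e' = Dom C j \<and> f = e' \<cdot> j)"
  then obtain j j' where 1: "split_epi e" "split_epi e'" "j \<in> Incl C" "j' \<in> Incl C"
    "Cod C e = Dom C j" "Cod C e' = Dom C j'" "f = e \<cdot> j" "f = e' \<cdot> j'"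
    by auto
  obtain r s where rs: "is_retraction C r" "is_iso C s" "Cod C r = Dom C s" "e = r \<cdot> s"
    using split_epi_factorisation[OF 1(1)] by blast
  obtain r' s' where rs': "is_retraction C r'" "is_iso C s'" "Cod C r' = Dom C s'" "e' = r' \<cdot> s'"
    using split_epi_factorisation[OF 1(2)] by blast
  have "Cod C e = Cod C s" "Cod C e' = Cod C s'"
    using rs rs' by (simp_all add: is_retraction_split_epi is_iso_Mor)
  then have "is_normal_factorisation C f (r, s, j)" "is_normal_factorisation C f (r', s', j')"
    using 1 rs rs' by simp_all
  then have "(r, s, j) = (r', s', j')"
    using unique_normal_factorisation[OF assms] by blast
  then show "e = e'"
    using rs rs' by simp
qed

definition epart :: "'b \<Rightarrow> 'b" where
  "epart f = (THE e. split_epi e \<and> (\<exists>j\<in>Incl C. Cod C e = Dom C j \<and> f = e \<cdot> j))"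

lemma epart_ex:
  assumes "f \<in> Mor C"
  shows "split_epi (epart f)" "\<exists>j\<in>Incl C. Cod C (epart f) = Dom C j \<and> f = epart f \<cdot> j"
  using theI'[OF epimorphic_component_ex1[OF assms]] unfolding epart_def by blast+

lemma epart_simps [simp]:
  assumes "f \<in> Mor C"
  shows "split_epi (epart f)" "epart f \<in> Mor C" "Dom C (epart f) = Dom C f"
    "Cod C f = b \<Longrightarrow> Cod C (epart f) \<sqsubseteq> b"
    "Cod C f = b \<Longrightarrow> epart f \<cdot> inc (Cod C (epart f)) b = f"
proof -
  obtain j where j: "j \<in> Incl C" "Cod C (epart f) = Dom C j" "f = epart f \<cdot> j"
    using epart_ex(2)[OF assms] by blast
  show e: "split_epi (epart f)" "epart f \<in> Mor C"
    using epart_ex[OF assms] by auto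
  have df: "Dom C (epart f \<cdot> j) = Dom C (epart f)" "Cod C (epart f \<cdot> j) = Cod C j"
    using e j(1,2) by simp_all
  then show "Dom C (epart f) = Dom C f" "Cod C f = b \<Longrightarrow> Cod C (epart f) \<sqsubseteq> b"
    using j sub_Incl[OF j(1)] by metis+
  show "Cod C f = b \<Longrightarrow> epart f \<cdot> inc (Cod C (epart f)) b = f"
    using df j inc_eq[OF j(1)] by metis
qed

lemma epart_eqI:
  assumes "split_epi e" "j \<in> Incl C" "Cod C e = Dom C j"
  shows "epart (e \<cdot> j) = e"
  unfolding epart_def
  by (rule the1_equality[OF epimorphic_component_ex1]) (use assms in auto)

lemma epart_split_epi: "split_epi e \<Longrightarrow> epart e = e"
  using epart_eqI[of e "Idt C (Cod C e)"] by simp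

lemma epart_cmp_Incl:
  assumes "f \<in> Mor C" "j \<in> Incl C" "Cod C f = Dom C j"
  shows "epart (f \<cdot> j) = epart f"
proof -
  let ?i = "inc (Cod C (epart f)) (Cod C f)"
  have "f \<cdot> j = epart f \<cdot> (?i \<cdot> j)"
    using assms cmp_assoc_Mor[of "epart f" ?i j] by simp
  then show ?thesis
    using epart_eqI[of "epart f" "?i \<cdot> j"] assms by (simp add: Incl_cmp)
qed

lemma epart_split_epi_cmp:
  assumes "split_epi e" "f \<in> Mor C" "Cod C e = Dom C f"
  shows "epart (e \<cdot> f) = e \<cdot> epart f"
proof -
  let ?i = "inc (Cod C (epart f)) (Cod C f)"
  have "e \<cdot> f = (e \<cdot> epart f) \<cdot> ?i"
    using assms cmp_assoc_Mor[of e "epart f" ?i] by simp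
  then show ?thesis
    using epart_eqI[of "e \<cdot> epart f" ?i] assms by (simp add: split_epi_cmp)
qed

text \<open>Only the restriction of \<open>g\<close> to the image of \<open>f\<close> matters.
  Together with \<open>epart_cmp_epart\<close> this gives associativity of the product of
  cones.\<close>

lemma epart_cmp:
  assumes "f \<in> Mor C" "g \<in> Mor C" "Cod C f = Dom C g"
  shows "epart (f \<cdot> g) = epart f \<cdot> epart (inc (Cod C (epart f)) (Cod C f) \<cdot> g)"
proof -
  let ?i = "inc (Cod C (epart f)) (Cod C f)"
  have "f \<cdot> g = epart f \<cdot> (?i \<cdot> g)"
    using assms cmp_assoc_Mor[of "epart f" ?i g] by simp
  then show ?thesis
    using epart_split_epi_cmp[of "epart f" "?i \<cdot> g"] assms by simp
qed

lemma epart_cmp_epart: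
  assumes "f \<in> Mor C" "g \<in> Mor C" "Cod C f = Dom C g"
  shows "epart (f \<cdot> epart g) = epart (f \<cdot> g)"
proof -
  let ?i = "inc (Cod C (epart g)) (Cod C g)"
  have "f \<cdot> g = (f \<cdot> epart g) \<cdot> ?i"
    using assms cmp_assoc_Mor[of f "epart g" ?i] by simp
  then show ?thesis
    using epart_cmp_Incl[of "f \<cdot> epart g" ?i] assms by simp
qed

text \<open>The epimorphic component of a split monomorphism is a split epimorphism with a right
  inverse, hence an isomorphism.\<close>

lemma split_mono_factorisation:
  assumes "m \<in> Mor C" "x \<in> Mor C" "Dom C x = Cod C m" "Cod C x = Dom C m" "m \<cdot> x = Idt C (Dom C m)"
  obtains t k where "is_iso C t" "k \<in> Incl C" "Cod C t = Dom C k" "m = t \<cdot> k"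
proof -
  let ?k = "inc (Cod C (epart m)) (Cod C m)"
  have "epart m \<cdot> (?k \<cdot> x) = Idt C (Dom C m)"
    using assms cmp_assoc_Mor[of "epart m" ?k x] by simp
  then have "is_iso C (epart m)"
    using assms by (intro is_iso_if_inverses[of _ "?k \<cdot> x"]) auto
  then show thesis
    using that[of "epart m" ?k] assms by simp
qed

text \<open>Write \<open>m = t k\<close> with \<open>t\<close> an isomorphism and \<open>k\<close>
  an inclusion. Then \<open>r t\<close> is a retraction for \<open>k\<close>, so \<open>r\<close>
  has the normal factorisation with factors \<open>r t\<close>, the inverse of \<open>t\<close>, and
  an identity. Comparing it with the trivial one forces \<open>t\<close> to be an identity.\<close>

lemma retraction_section_Incl:
  assumes "is_retraction C r" "m \<in> Mor C" "Dom C m = Cod C r" "Cod C m = Dom C r" "m \<cdot> r = Idt C (Cod C r)"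
  shows "m \<in> Incl C"
proof -
  have r: "r \<in> Mor C"
    using assms(1) by (simp add: is_retraction_split_epi)
  obtain t k where tk: "is_iso C t" "k \<in> Incl C" "Cod C t = Dom C k" "m = t \<cdot> k"
    using split_mono_factorisation[OF assms(2) r] assms by metis
  obtain t' where t': "t \<in> Mor C" "t' \<in> Mor C" "Dom C t' = Cod C t" "Cod C t' = Dom C t"
    "t \<cdot> t' = Idt C (Dom C t)" "t' \<cdot> t = Idt C (Cod C t)"
    using tk(1) by (rule is_isoE)
  have dt: "Dom C t = Cod C r" "Cod C k = Dom C r"
    using tk t' assms(3,4) by simp_all
  have "t \<cdot> (k \<cdot> r) = t \<cdot> t'"
    using assms(5) tk t' dt r cmp_assoc_Mor[of t k r] by simp
  then have kr: "k \<cdot> r = t'"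
    using split_epi_cancel[of t "k \<cdot> r" t'] is_iso_split_epi[OF tk(1)] tk t' dt r by simp
  have "is_retraction C (r \<cdot> t)"
    using tk t' dt r kr cmp_assoc_Mor[of k r t] by (intro is_retractionI[of _ k]) auto
  moreover have "is_iso C t'"
    using t' by (intro is_isoI[of _ t]) auto
  moreover have "r = (r \<cdot> t) \<cdot> t' \<cdot> Idt C (Cod C r)"
    using t' dt r by (simp add: cmp_assoc_Mor)
  ultimately have "is_normal_factorisation C r (r \<cdot> t, t', Idt C (Cod C r))"
    using tk t' dt r by simp
  moreover have "is_normal_factorisation C r (r, Idt C (Cod C r), Idt C (Cod C r))"
    using assms(1) r by (simp add: is_iso_Idt)
  ultimately have "t' = Idt C (Cod C r)"
    using unique_normal_factorisation[OF r] by blast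
  then have "t = Idt C (Cod C r)"
    using t' dt r by (metis Idt_cmp(2) Cod_Obj Idt_Mor(2,3))
  then have "m = k"
    using tk dt by (metis Idt_cmp(1) Cod_Obj Idt_Mor(3) Incl_in_Mor r)
  then show ?thesis
    using tk by simp
qed

text \<open>With \<open>f = e j\<close> and \<open>e = r s\<close>, cancelling in
  \<open>f g f = f\<close> shows that \<open>g e\<close> is the retraction of \<open>j\<close> and
  that \<open>s j g\<close> is a section of \<open>r\<close>. Both are unique, and
  \<open>g = g f g = (g e) (j g)\<close>.\<close>

lemma endo_inverse_unique:
  assumes "f \<in> Hom C c c" "g \<in> Hom C c c" "f \<cdot> g \<cdot> f = f" "g \<cdot> f \<cdot> g = g"
    "h \<in> Hom C c c" "f \<cdot> h \<cdot> f = f" "h \<cdot> f \<cdot> h = h"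
  shows "g = h"
proof -
  have f: "f \<in> Mor C" "Dom C f = c" "Cod C f = c"
    using assms(1) by (auto simp: Hom_def)
  obtain r s j where nf: "is_normal_factorisation C f (r, s, j)"
    using unique_normal_factorisation[OF f(1)] by (metis prod_cases3)
  then have 1: "is_retraction C r" "is_iso C s" "j \<in> Incl C" "Cod C r = Dom C s" "Cod C s = Dom C j"
    "f = r \<cdot> s \<cdot> j"
    by simp_all
  then have M: "r \<in> Mor C" "s \<in> Mor C" "j \<in> Mor C"
    by (auto simp: is_retraction_split_epi is_iso_Mor)
  define e where "e = r \<cdot> s"
  have e: "split_epi e" "Dom C e = c" "Cod C e = Dom C j" "Cod C j = c" "f = e \<cdot> j" "Dom C r = c"
    using f 1 M by (simp_all add: e_def split_epi_cmp is_retraction_split_epi is_iso_split_epi)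
  obtain s' where s': "s' \<in> Mor C" "Dom C s' = Cod C s" "Cod C s' = Dom C s"
    "s \<cdot> s' = Idt C (Dom C s)" "s' \<cdot> s = Idt C (Cod C s)"
    using 1(2) by (rule is_isoE)
  obtain i where i: "i \<in> Incl C" "Dom C i = Cod C r" "Cod C i = Dom C r" "i \<cdot> r = Idt C (Cod C r)"
    using 1(1) by (rule is_retractionE)
  obtain q where q: "splits_by C j q" "\<And>q'. splits_by C j q' \<Longrightarrow> q' = q"
    using incl_splits_uniquely[OF 1(3)] by blast
  have "g = q \<cdot> (s' \<cdot> i)" if g: "g \<in> Hom C c c" "f \<cdot> g \<cdot> f = f" "g \<cdot> f \<cdot> g = g" for g
  proof -
    have gM: "g \<in> Mor C" "Dom C g = c" "Cod C g = c"
      using g by (auto simp: Hom_def)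
    have "(e \<cdot> (j \<cdot> (g \<cdot> e))) \<cdot> j = e \<cdot> j"
      using g(2) gM e M by (simp add: cmp_assoc_Mor)
    then have "e \<cdot> (j \<cdot> (g \<cdot> e)) = e \<cdot> Idt C (Dom C j)"
      using Incl_cancel[of j "e \<cdot> (j \<cdot> (g \<cdot> e))" e] gM e M 1 by simp
    then have jge: "j \<cdot> (g \<cdot> e) = Idt C (Dom C j)"
      using split_epi_cancel[of e "j \<cdot> (g \<cdot> e)" "Idt C (Dom C j)"] gM e M by simp
    have ge: "g \<cdot> e = q"
      using q(2)[of "g \<cdot> e"] jge gM e 1 by (simp add: splits_by_def Hom_def)
    \<comment> \<open>This uses \<open>r = r s s' = e s'\<close>.\<close>
    have "s \<cdot> (j \<cdot> g) \<cdot> r = s \<cdot> (j \<cdot> (g \<cdot> e)) \<cdot> s'"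
      using gM e M 1 s' by (simp add: e_def cmp_assoc_Mor)
    also have "\<dots> = Idt C (Cod C r)"
      unfolding jge using 1 M s' by (metis Idt_cmp(2))
    finally have "s \<cdot> (j \<cdot> g) \<cdot> r = Idt C (Cod C r)" .
    then have "s \<cdot> (j \<cdot> g) \<in> Incl C"
      using gM e M 1 by (intro retraction_section_Incl[of r]) auto
    then have sjg: "s \<cdot> (j \<cdot> g) = i"
      using i gM e M 1 by (intro Incl_eq) auto
    have "s' \<cdot> i = (s' \<cdot> s) \<cdot> (j \<cdot> g)"
      unfolding sjg[symmetric] using gM e M 1 s'(1-3) by (simp add: cmp_assoc_Mor)
    then have jg: "s' \<cdot> i = j \<cdot> g"
      using s' gM e M 1 by simp
    have "g = (g \<cdot> e) \<cdot> (j \<cdot> g)"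
      using g(3) gM e M by (simp add: cmp_assoc_Mor)
    then show ?thesis
      using ge jg by simp
  qed
  then show "g = h"
    using assms by metis
qed

end

section \<open>The semigroup of normal cones\<close>

context unambiguous_category
begin

text \<open>Values outside the objects are fixed, so that cones with equal components are equal
  functions.\<close>

definition cone :: "('a \<Rightarrow> 'b) \<Rightarrow> bool" where
  "cone \<gamma> \<longleftrightarrow> \<gamma> \<in> extensional (Obj C) \<and> (\<exists>d. is_normal_cone C d \<gamma>)"

text \<open>All components of a cone share their codomain, so it can be read off at any
  object.\<close>

definition apex :: "('a \<Rightarrow> 'b) \<Rightarrow> 'a" where
  "apex \<gamma> = Cod C (\<gamma> (SOME a. a \<in> Obj C))"

lemma apex_eq:
  assumes "is_normal_cone C d \<gamma>"
  shows "apex \<gamma> = d"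
  using assms some_in_eq[of "Obj C"] Obj_nonempty
  unfolding apex_def is_normal_cone_def Hom_def by auto

lemma cone_apex: "cone \<gamma> \<Longrightarrow> is_normal_cone C (apex \<gamma>) \<gamma>"
  using apex_eq unfolding cone_def by blast

lemma cone_component [simp]:
  assumes "cone \<gamma>" "a \<in> Obj C"
  shows "\<gamma> a \<in> Mor C" "Dom C (\<gamma> a) = a" "Cod C (\<gamma> a) = apex \<gamma>"
  using cone_apex[OF assms(1)] assms(2) by (auto simp: is_normal_cone_def Hom_def)

lemma apex_Obj [simp]: "cone \<gamma> \<Longrightarrow> apex \<gamma> \<in> Obj C"
  using cone_apex by (auto simp: is_normal_cone_def)

lemma cone_Incl: "\<lbrakk>cone \<gamma>; j \<in> Incl C\<rbrakk> \<Longrightarrow> j \<cdot> \<gamma> (Cod C j) = \<gamma> (Dom C j)"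
  using cone_apex by (auto simp: is_normal_cone_def)

lemma cone_inc: "\<lbrakk>cone \<gamma>; a \<sqsubseteq> b\<rbrakk> \<Longrightarrow> inc a b \<cdot> \<gamma> b = \<gamma> a"
  using cone_Incl[of \<gamma> "inc a b"] by simp

lemma cone_iso:
  assumes "cone \<gamma>"
  obtains a where "a \<in> Obj C" "is_iso C (\<gamma> a)"
  using cone_apex[OF assms] by (auto simp: is_normal_cone_def)

lemma cone_eqI:
  "\<lbrakk>cone \<gamma>; cone \<delta>; \<And>a. a \<in> Obj C \<Longrightarrow> \<gamma> a = \<delta> a\<rbrakk> \<Longrightarrow> \<gamma> = \<delta>"
  unfolding cone_def by (auto intro: extensionalityI)

definition post :: "('a \<Rightarrow> 'b) \<Rightarrow> 'b \<Rightarrow> 'a \<Rightarrow> 'b" where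
  "post \<gamma> e = (\<lambda>a\<in>Obj C. \<gamma> a \<cdot> e)"

lemma post_apply [simp]: "a \<in> Obj C \<Longrightarrow> post \<gamma> e a = \<gamma> a \<cdot> e"
  by (simp add: post_def)

lemma normal_cone_post:
  assumes "cone \<gamma>" "split_epi e" "Dom C e = apex \<gamma>"
  shows "is_normal_cone C (Cod C e) (post \<gamma> e)"
  unfolding is_normal_cone_def
proof (intro conjI ballI)
  show "Cod C e \<in> Obj C"
    using assms by simp
  show "post \<gamma> e a \<in> Hom C a (Cod C e)" if "a \<in> Obj C" for a
    using assms that by (simp add: Hom_def)
  show "j \<cdot> post \<gamma> e (Cod C j) = post \<gamma> e (Dom C j)" if "j \<in> Incl C" for j
    using assms that cone_Incl[of \<gamma> j] cmp_assoc_Mor[of j "\<gamma> (Cod C j)" e] by simp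
  \<comment> \<open>A section of \<open>e\<close> followed by the inverse of an isomorphism component of \<open>\<gamma>\<close> is a split
    monomorphism; its image is an object at which the new cone is an isomorphism.\<close>
  obtain a where a: "a \<in> Obj C" "is_iso C (\<gamma> a)"
    using cone_iso[OF assms(1)] .
  obtain g where g: "g \<in> Mor C" "Dom C g = Cod C (\<gamma> a)" "Cod C g = Dom C (\<gamma> a)"
    "g \<cdot> \<gamma> a = Idt C (Cod C (\<gamma> a))"
    using a(2) by (rule is_isoE)
  obtain x where x: "x \<in> Mor C" "Dom C x = Cod C e" "Cod C x = Dom C e" "x \<cdot> e = Idt C (Cod C e)"
    using assms(2) by (rule split_epiE)
  have eM: "e \<in> Mor C"
    using assms by simp
  have xg: "(x \<cdot> g) \<cdot> (\<gamma> a) = x"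
    using a g x assms by (simp add: cmp_assoc_Mor)
  have "(x \<cdot> g) \<cdot> (\<gamma> a \<cdot> e) = Idt C (Cod C e)"
    using a g(1-3) x assms xg cmp_assoc_Mor[of "x \<cdot> g" "\<gamma> a" e] by simp
  then obtain t k where tk: "is_iso C t" "k \<in> Incl C" "Cod C t = Dom C k" "x \<cdot> g = t \<cdot> k"
    using split_mono_factorisation[of "x \<cdot> g" "\<gamma> a \<cdot> e"] a g x assms eM by auto
  have kM: "k \<in> Mor C" "t \<in> Mor C"
    using tk by (simp_all add: is_iso_Mor)
  have kt: "Cod C k = a" "Dom C t = Cod C e"
    using cmp_Mor(2,3)[OF kM(2,1) tk(3)] tk(4)[symmetric] g x assms a by simp_all
  have b: "Dom C k \<in> Obj C"
    using kM by simp
  have "t \<cdot> \<gamma> (Dom C k) = x"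
    using xg unfolding tk(4) using cone_Incl[OF assms(1) tk(2)] kt kM tk assms a by (simp add: cmp_assoc_Mor)
  then have 1: "t \<cdot> (\<gamma> (Dom C k) \<cdot> e) = Idt C (Cod C e)"
    using x kt kM tk assms b cmp_assoc_Mor[of t "\<gamma> (Dom C k)" e] by simp
  obtain t' where t': "t' \<in> Mor C" "Dom C t' = Cod C t" "Cod C t' = Dom C t"
    "t \<cdot> t' = Idt C (Dom C t)" "t' \<cdot> t = Idt C (Cod C t)"
    using tk(1) by (rule is_isoE)
  have 2: "t \<cdot> (\<gamma> (Dom C k) \<cdot> e) = t \<cdot> t'"
    using 1 t' kt by simp
  have "\<gamma> (Dom C k) \<cdot> e = t'"
    by (rule split_epi_cancel[OF is_iso_split_epi[OF tk(1)] _ _ _ _ 2])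
      (use t'(1-3) kt kM tk(3) assms b in simp_all)
  moreover have "is_iso C t'"
    using t' kM by (intro is_isoI[of _ t]) auto
  ultimately show "\<exists>c\<in>Obj C. is_iso C (post \<gamma> e c)"
    using b by (intro bexI[of _ "Dom C k"]) auto
qed

lemma cone_post:
  assumes "cone \<gamma>" "split_epi e" "Dom C e = apex \<gamma>"
  shows "cone (post \<gamma> e)" "apex (post \<gamma> e) = Cod C e"
  using normal_cone_post[OF assms] apex_eq by (auto simp: cone_def post_def)

lemma post_post:
  assumes "cone \<gamma>" "split_epi e" "Dom C e = apex \<gamma>" "split_epi f" "Dom C f = Cod C e"
  shows "post (post \<gamma> e) f = post \<gamma> (e \<cdot> f)"
  using assms by (intro cone_eqI) (auto simp: cone_post split_epi_cmp cmp_assoc_Mor)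

lemma post_Idt: "cone \<gamma> \<Longrightarrow> a = apex \<gamma> \<Longrightarrow> post \<gamma> (Idt C a) = \<gamma>"
  by (intro cone_eqI) (auto simp: cone_post split_epi_Idt)

text \<open>Postcomposing with \<open>\<delta> (apex \<gamma>)\<close> itself need not leave an
  isomorphism component; with its epimorphic component it does, by
  \<open>normal_cone_post\<close>.\<close>

definition TC :: "('a \<Rightarrow> 'b) sgrp" where
  "TC = \<lparr>Car = {\<gamma>. cone \<gamma>}, mul = (\<lambda>\<gamma> \<delta>. post \<gamma> (epart (\<delta> (apex \<gamma>))))\<rparr>"

lemma TC_simps [simp]:
  "Car TC = {\<gamma>. cone \<gamma>}"
  "\<gamma> \<odot>\<^bsub>TC\<^esub> \<delta> = post \<gamma> (epart (\<delta> (apex \<gamma>)))"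
  by (simp_all add: TC_def)

lemma cone_at:
  assumes "c \<in> Obj C"
  obtains \<mu> where "cone \<mu>" "apex \<mu> = c" "\<mu> c = Idt C c"
proof -
  obtain d \<mu> where \<mu>: "is_normal_cone C d \<mu>" "\<mu> c = Idt C c"
    using normal_cone_at[OF assms] by blast
  have "d = Cod C (\<mu> c)"
    using \<mu>(1) assms by (auto simp: is_normal_cone_def Hom_def)
  then have d: "d = c"
    using \<mu>(2) assms by simp
  have "is_normal_cone C d (restrict \<mu> (Obj C))"
    using \<mu>(1) unfolding is_normal_cone_def by simp
  then show thesis
    using that[of "restrict \<mu> (Obj C)"] apex_eq \<mu>(2) assms d by (auto simp: cone_def)
qed

lemma cone_mul:
  assumes "cone \<gamma>" "cone \<delta>"
  shows "cone (post \<gamma> (epart (\<delta> (apex \<gamma>))))"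
    "apex (post \<gamma> (epart (\<delta> (apex \<gamma>)))) = Cod C (epart (\<delta> (apex \<gamma>)))"
    "Cod C (epart (\<delta> (apex \<gamma>))) \<sqsubseteq> apex \<delta>"
  using assms epart_simps(4)[of "\<delta> (apex \<gamma>)"] by (simp_all add: cone_post)

lemma regular_semigroup_TC: "regular_semigroup TC"
proof
  obtain c where "c \<in> Obj C"
    using Obj_nonempty by blast
  then obtain \<mu> where "cone \<mu>"
    using cone_at by metis
  then show "Car TC \<noteq> {}"
    by auto
next
  fix \<gamma> \<delta> assume "\<gamma> \<in> Car TC" "\<delta> \<in> Car TC"
  then show "\<gamma> \<odot>\<^bsub>TC\<^esub> \<delta> \<in> Car TC"
    by (simp add: cone_mul)
next
  fix \<gamma> \<delta> \<eta> assume "\<gamma> \<in> Car TC" "\<delta> \<in> Car TC" "\<eta> \<in> Car TC"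
  then have c: "cone \<gamma>" "cone \<delta>" "cone \<eta>"
    by auto
  let ?f = "\<delta> (apex \<gamma>)"
  let ?g = "\<eta> (apex \<delta>)"
  have i: "Cod C (epart ?f) \<sqsubseteq> apex \<delta>"
    using c by (simp add: cone_mul)
  \<comment> \<open>Both bracketings postcompose \<open>\<gamma>\<close> with one morphism: the left
    side here for \<open>\<gamma> (\<delta> \<eta>)\<close>, the right side for
    \<open>(\<gamma> \<delta>) \<eta>\<close>.\<close>
  have "epart (?f \<cdot> epart ?g) = epart ?f \<cdot> epart (\<eta> (Cod C (epart ?f)))"
    using c i epart_cmp_epart[of ?f ?g] epart_cmp[of ?f ?g]
      cone_inc[OF c(3) i] by simp
  then show "\<gamma> \<odot>\<^bsub>TC\<^esub> \<delta> \<odot>\<^bsub>TC\<^esub> \<eta> = \<gamma> \<odot>\<^bsub>TC\<^esub> (\<delta> \<odot>\<^bsub>TC\<^esub> \<eta>)"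
    using c by (simp add: cone_mul(2) post_post)
next
  fix \<gamma> assume "\<gamma> \<in> Car TC"
  then have c: "cone \<gamma>"
    by auto
  obtain a where a: "a \<in> Obj C" "is_iso C (\<gamma> a)"
    using cone_iso[OF c] .
  obtain g where g: "g \<in> Mor C" "Dom C g = Cod C (\<gamma> a)" "Cod C g = Dom C (\<gamma> a)"
    "\<gamma> a \<cdot> g = Idt C (Dom C (\<gamma> a))" "g \<cdot> \<gamma> a = Idt C (Cod C (\<gamma> a))"
    using a(2) by (rule is_isoE)
  have "is_iso C g"
    using a g c by (intro is_isoI[of _ "\<gamma> a"]) auto
  then have sg: "split_epi g" "epart g = g"
    by (simp_all add: is_iso_split_epi epart_split_epi)
  have sga: "epart (\<gamma> a) = \<gamma> a" "split_epi (\<gamma> a)"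
    using a by (simp_all add: is_iso_split_epi epart_split_epi)
  \<comment> \<open>The required element is \<open>post \<mu> g\<close>: its component at
    \<open>apex \<gamma>\<close> is \<open>g\<close>, so \<open>\<gamma>\<close> times it is
    \<open>post \<gamma> g\<close> with apex \<open>a\<close>, and a further factor
    \<open>\<gamma>\<close> contributes \<open>\<gamma> a\<close>, which undoes
    \<open>g\<close>.\<close>
  obtain \<mu> where \<mu>: "cone \<mu>" "apex \<mu> = apex \<gamma>" "\<mu> (apex \<gamma>) = Idt C (apex \<gamma>)"
    using cone_at[of "apex \<gamma>"] c by auto
  have "cone (post \<mu> g)"
    using \<mu> sg g a c by (simp add: cone_post)
  moreover have "\<gamma> \<odot>\<^bsub>TC\<^esub> post \<mu> g \<odot>\<^bsub>TC\<^esub> \<gamma> = \<gamma>"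
    using \<mu> sg sga g a c by (simp add: cone_post post_post post_Idt)
  ultimately show "\<exists>\<delta>\<in>Car TC. \<gamma> \<odot>\<^bsub>TC\<^esub> \<delta> \<odot>\<^bsub>TC\<^esub> \<gamma> = \<gamma>"
    by (intro bexI[of _ "post \<mu> g"]) auto
qed

text \<open>For an idempotent, comparing components at an object where \<open>\<epsilon>\<close> is
  an isomorphism cancels to show that the epimorphic component of
  \<open>\<epsilon> (apex \<epsilon>)\<close> is an identity; its inclusion part then is one
  too.\<close>

lemma idems_TC_iff: "\<epsilon> \<in> idems TC \<longleftrightarrow> cone \<epsilon> \<and> \<epsilon> (apex \<epsilon>) = Idt C (apex \<epsilon>)"
proof (intro iffI conjI)
  assume "\<epsilon> \<in> idems TC"
  then have c: "cone \<epsilon>" and id: "post \<epsilon> (epart (\<epsilon> (apex \<epsilon>))) = \<epsilon>"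
    by (auto simp: idems_def)
  show "cone \<epsilon>"
    by (rule c)
  let ?f = "\<epsilon> (apex \<epsilon>)"
  obtain a where a: "a \<in> Obj C" "is_iso C (\<epsilon> a)"
    using cone_iso[OF c] .
  have cf: "Cod C (epart ?f) = apex \<epsilon>"
    using cone_mul(2)[OF c c] id by simp
  have "\<epsilon> a \<cdot> epart ?f = \<epsilon> a \<cdot> Idt C (apex \<epsilon>)"
    using fun_cong[OF id, of a] a c by simp
  then have "epart ?f = Idt C (apex \<epsilon>)"
    using a c cf split_epi_cancel[OF is_iso_split_epi[OF a(2)], of "epart ?f" "Idt C (apex \<epsilon>)"] by simp
  then show "?f = Idt C (apex \<epsilon>)"
    using epart_simps(5)[of ?f] cf c by simp
next
  assume "cone \<epsilon> \<and> \<epsilon> (apex \<epsilon>) = Idt C (apex \<epsilon>)"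
  then show "\<epsilon> \<in> idems TC"
    by (simp add: idems_def epart_split_epi split_epi_Idt post_Idt)
qed

text \<open>Compatibility with the inclusion of \<open>a\<close> into the apex, where the component
  is an identity, fixes the value at \<open>a\<close>. Hence \<open>\<epsilon>\<close> is a right
  identity for every cone with apex below its own.\<close>

lemma idems_TC_inc:
  assumes "\<epsilon> \<in> idems TC" "a \<sqsubseteq> apex \<epsilon>"
  shows "\<epsilon> a = inc a (apex \<epsilon>)" "epart (\<epsilon> a) = Idt C a"
proof -
  have e: "cone \<epsilon>" "\<epsilon> (apex \<epsilon>) = Idt C (apex \<epsilon>)"
    using assms(1) by (auto simp: idems_TC_iff)
  show 1: "\<epsilon> a = inc a (apex \<epsilon>)"
    using cone_inc[OF e(1) assms(2)] e assms(2) by simp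
  have "Idt C a \<cdot> inc a (apex \<epsilon>) = inc a (apex \<epsilon>)"
    using assms(2) by simp
  then show "epart (\<epsilon> a) = Idt C a"
    using 1 epart_eqI[of "Idt C a" "inc a (apex \<epsilon>)"] assms(2) sub_Obj[OF assms(2)]
    by (simp add: split_epi_Idt)
qed

definition ideal_at :: "'a \<Rightarrow> ('a \<Rightarrow> 'b) set" where
  "ideal_at c = {\<gamma>. cone \<gamma> \<and> apex \<gamma> \<sqsubseteq> c}"

text \<open>A product ending in \<open>\<epsilon>\<close> has apex below
  \<open>apex \<epsilon>\<close>, and cones with such an apex are fixed by
  \<open>\<epsilon>\<close>.\<close>

lemma left_ideal_TC:
  assumes "\<epsilon> \<in> idems TC"
  shows "left_ideal TC \<epsilon> = ideal_at (apex \<epsilon>)"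
proof -
  have e: "cone \<epsilon>"
    using assms by (auto simp: idems_TC_iff)
  have "\<gamma> = post \<gamma> (epart (\<epsilon> (apex \<gamma>)))" if "\<gamma> \<in> ideal_at (apex \<epsilon>)" for \<gamma>
    using that idems_TC_inc(2)[OF assms, of "apex \<gamma>"] by (simp add: ideal_at_def post_Idt)
  then show ?thesis
    using e unfolding left_ideal_def by (auto simp: ideal_at_def cone_mul)
qed

text \<open>Evaluating \<open>\<epsilon> u = u\<close> at \<open>apex \<epsilon>\<close>, where
  \<open>\<epsilon>\<close> is an identity, shows that this single component of \<open>u\<close>
  equals its own epimorphic component and determines \<open>u\<close>.\<close>

lemma corner_TC:
  assumes "\<epsilon> \<in> idems TC" "\<zeta> \<in> idems TC" "u \<in> corner TC \<epsilon> \<zeta>"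
  shows "cone u" "apex u \<sqsubseteq> apex \<zeta>" "u = post \<epsilon> (u (apex \<epsilon>))" "split_epi (u (apex \<epsilon>))"
proof -
  have e: "cone \<epsilon>" "cone \<zeta>" "\<epsilon> (apex \<epsilon>) = Idt C (apex \<epsilon>)"
    using assms by (auto simp: idems_TC_iff)
  interpret TC: regular_semigroup TC
    by (rule regular_semigroup_TC)
  obtain x where x: "cone x" "u = \<epsilon> \<odot>\<^bsub>TC\<^esub> x \<odot>\<^bsub>TC\<^esub> \<zeta>"
    using assms(3) by (auto simp: corner_def)
  have xe: "cone (\<epsilon> \<odot>\<^bsub>TC\<^esub> x)"
    using x e by (simp add: cone_mul)
  show u: "cone u" "apex u \<sqsubseteq> apex \<zeta>"
    unfolding x(2) TC_simps(2)[of _ \<zeta>] using cone_mul[OF xe e(2)] by simp_all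
  have "\<epsilon> \<odot>\<^bsub>TC\<^esub> u = u"
  proof -
    have "\<epsilon> \<odot>\<^bsub>TC\<^esub> \<epsilon> = \<epsilon>"
      using assms(1) by (simp add: idems_def)
    moreover have "\<epsilon> \<odot>\<^bsub>TC\<^esub> u = (\<epsilon> \<odot>\<^bsub>TC\<^esub> \<epsilon>) \<odot>\<^bsub>TC\<^esub> x \<odot>\<^bsub>TC\<^esub> \<zeta>"
      unfolding x(2) using TC.assoc TC.closed e x(1) by (simp del: TC_simps(2))
    ultimately show ?thesis
      using x(2) by simp
  qed
  then have 1: "post \<epsilon> (epart (u (apex \<epsilon>))) = u"
    by simp
  have "u (apex \<epsilon>) = epart (u (apex \<epsilon>))"
    using fun_cong[OF 1, of "apex \<epsilon>"] e u by simp
  then show "u = post \<epsilon> (u (apex \<epsilon>))" "split_epi (u (apex \<epsilon>))"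
    using 1 epart_simps(1)[of "u (apex \<epsilon>)"] u e by simp_all
qed

lemma post_in_corner_TC:
  assumes "\<epsilon> \<in> idems TC" "\<zeta> \<in> idems TC" "split_epi e" "Dom C e = apex \<epsilon>" "Cod C e \<sqsubseteq> apex \<zeta>"
  shows "post \<epsilon> e \<in> corner TC \<epsilon> \<zeta>"
proof -
  have e: "cone \<epsilon>" "cone \<zeta>" "\<epsilon> (apex \<epsilon>) = Idt C (apex \<epsilon>)"
    using assms by (auto simp: idems_TC_iff)
  have c: "cone (post \<epsilon> e)" "apex (post \<epsilon> e) = Cod C e"
    using cone_post assms e by simp_all
  have "\<epsilon> \<odot>\<^bsub>TC\<^esub> post \<epsilon> e = post \<epsilon> e"
    using assms e by (simp add: epart_split_epi)
  moreover have "post \<epsilon> e \<odot>\<^bsub>TC\<^esub> \<zeta> = post \<epsilon> e"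
    using idems_TC_inc[OF assms(2,5)] c by (simp add: post_Idt)
  ultimately have "post \<epsilon> e = \<epsilon> \<odot>\<^bsub>TC\<^esub> post \<epsilon> e \<odot>\<^bsub>TC\<^esub> \<zeta>"
    by simp
  then show ?thesis
    using c unfolding corner_def by auto
qed

text \<open>\<open>u \<mapsto> u(c) \<iota>(apex u, c)\<close>, with \<open>c\<close> the apex of \<open>\<epsilon>\<close>, embeds the local submonoid at \<open>\<epsilon>\<close>
  into the endomorphism monoid of \<open>c\<close>, where inverses are unique.\<close>

lemma corner_TC_inverse_unique:
  assumes "\<epsilon> \<in> idems TC" "u \<in> corner TC \<epsilon> \<epsilon>" "v \<in> corner TC \<epsilon> \<epsilon>" "w \<in> corner TC \<epsilon> \<epsilon>"
    "u \<odot>\<^bsub>TC\<^esub> v \<odot>\<^bsub>TC\<^esub> u = u" "v \<odot>\<^bsub>TC\<^esub> u \<odot>\<^bsub>TC\<^esub> v = v" "u \<odot>\<^bsub>TC\<^esub> w \<odot>\<^bsub>TC\<^esub> u = u" "w \<odot>\<^bsub>TC\<^esub> u \<odot>\<^bsub>TC\<^esub> w = w"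
  shows "v = w"
proof -
  let ?c = "apex \<epsilon>"
  have e: "cone \<epsilon>" "\<epsilon> ?c = Idt C ?c"
    using assms by (auto simp: idems_TC_iff)
  define P where "P x = x ?c \<cdot> inc (apex x) ?c" for x
  have hom: "P (x \<odot>\<^bsub>TC\<^esub> y) = P x \<cdot> P y" if "cone x" "apex x \<sqsubseteq> ?c" "cone y" "apex y \<sqsubseteq> ?c" for x y
  proof -
    let ?f = "y (apex x)"
    have f: "Cod C (epart ?f) \<sqsubseteq> apex y"
      using cone_mul(3)[OF that(1,3)] .
    have "P (x \<odot>\<^bsub>TC\<^esub> y) = x ?c \<cdot> (epart ?f \<cdot> inc (Cod C (epart ?f)) ?c)"
      using that e f sub_trans[OF f that(4)] by (simp add: P_def cone_mul cmp_assoc_Mor)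
    also have "epart ?f \<cdot> inc (Cod C (epart ?f)) ?c
        = (epart ?f \<cdot> inc (Cod C (epart ?f)) (apex y)) \<cdot> inc (apex y) ?c"
      using that f by (simp add: cmp_assoc_Mor del: epart_simps(5))
    \<comment> \<open>As \<open>apex x\<close> lies below \<open>?c\<close>, the component of
      \<open>y\<close> there is the restriction of \<open>y ?c\<close>.\<close>
    also have "\<dots> = (inc (apex x) ?c \<cdot> y ?c) \<cdot> inc (apex y) ?c"
      using epart_simps(5)[of ?f] cone_inc[OF that(3,2)] that by simp
    finally show ?thesis
      using that e by (simp add: P_def cmp_assoc_Mor)
  qed
  \<comment> \<open>The last equation makes \<open>P\<close> injective on the corner: the epimorphic
    component of \<open>P x\<close> is \<open>x ?c\<close>.\<close>
  have P: "P x \<in> Hom C ?c ?c" "cone x" "apex x \<sqsubseteq> ?c" "x = post \<epsilon> (epart (P x))" if "x \<in> corner TC \<epsilon> \<epsilon>" for x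
  proof -
    note x = corner_TC[OF assms(1,1) that]
    show "P x \<in> Hom C ?c ?c" "cone x" "apex x \<sqsubseteq> ?c"
      using x e by (auto simp: P_def Hom_def)
    have "epart (P x) = x ?c"
      using x e by (simp add: P_def epart_eqI)
    then show "x = post \<epsilon> (epart (P x))"
      using x(3) by simp
  qed
  have mul: "cone (x \<odot>\<^bsub>TC\<^esub> y)" "apex (x \<odot>\<^bsub>TC\<^esub> y) \<sqsubseteq> ?c" if "cone x" "cone y" "apex y \<sqsubseteq> ?c" for x y
    using cone_mul[OF that(1,2)] sub_trans that(3) by simp_all
  have hom3: "P x \<cdot> P y \<cdot> P z = P (x \<odot>\<^bsub>TC\<^esub> y \<odot>\<^bsub>TC\<^esub> z)"
    if "x \<in> corner TC \<epsilon> \<epsilon>" "y \<in> corner TC \<epsilon> \<epsilon>" "z \<in> corner TC \<epsilon> \<epsilon>" for x y z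
    using that P mul by (simp add: hom del: TC_simps)
  have "P v = P w"
    by (rule endo_inverse_unique[of "P u" ?c]) (simp_all only: P(1) hom3 assms)
  then show ?thesis
    using P(4) assms by metis
qed

end

text \<open>Regularity already provides inverses inside \<open>eSe\<close>: if
  \<open>x y x = x\<close>, then \<open>e (y x y) e\<close> is one. Only uniqueness has to be
  checked.\<close>

lemma (in regular_semigroup) locally_inverse_semigroupI:
  assumes "\<And>e x y z. \<lbrakk>e \<in> idems S; x \<in> corner S e e; y \<in> corner S e e; z \<in> corner S e e;
    x \<odot> y \<odot> x = x; y \<odot> x \<odot> y = y; x \<odot> z \<odot> x = x; z \<odot> x \<odot> z = z\<rbrakk> \<Longrightarrow> y = z"
  shows "locally_inverse_semigroup S"
proof (intro locally_inverse_semigroup.intro locally_inverse_semigroup_axioms.intro regular_semigroup_axioms)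
  fix e assume e: "e \<in> idems S"
  note ec = idemsD[OF e] and corner = corner_iff[OF e e]
  have ee: "e \<odot> (e \<odot> x) = e \<odot> x" if "x \<in> Car S" for x
    using ec that by (metis assoc)
  have 1: "x \<odot> y \<in> corner S e e" if "x \<in> corner S e e" "y \<in> corner S e e" for x y
    using that ec unfolding corner by (metis assoc closed)
  have 2: "\<exists>!y. y \<in> corner S e e \<and> x \<odot> y \<odot> x = x \<and> y \<odot> x \<odot> y = y" if x: "x \<in> corner S e e" for x
  proof -
    have xc: "x \<in> Car S" "e \<odot> x = x" "x \<odot> e = x"
      using x by (auto simp: corner)
    obtain y where y: "y \<in> Car S" "x \<odot> y \<odot> x = x"
      using regular xc by blast
    have xyx: "x \<odot> (y \<odot> x) = x" "x \<odot> (y \<odot> (x \<odot> z)) = x \<odot> z"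
      and xe: "x \<odot> (e \<odot> z) = x \<odot> z" if "z \<in> Car S" for z
      using y xc ec that by (metis assoc closed)+
    define w where "w = e \<odot> (y \<odot> x \<odot> y) \<odot> e"
    have "w \<in> corner S e e" "x \<odot> w \<odot> x = x" "w \<odot> x \<odot> w = w"
      using xc y ec unfolding w_def corner by (simp_all add: assoc closed ee xe xyx)
    then show ?thesis
      using assms e x by blast
  qed
  have "e \<in> corner S e e"
    using corner ec by simp
  then show "inverse_semigroup (S\<lparr>Car := corner S e e\<rparr>)"
    by unfold_locales (use 1 2 corner assoc in auto)
qed

lemma (in unambiguous_category) locally_inverse_semigroup_TC: "locally_inverse_semigroup TC"
  using corner_TC_inverse_unique
  by (intro regular_semigroup.locally_inverse_semigroupI[OF regular_semigroup_TC]) blast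

text \<open>The inverse functor consists of the inverse bijections. Equality in \<open>incl\<close>,
  rather than containment, makes it preserve inclusions.\<close>

lemma subobj_isomorphicI:
  assumes C: "small_category C" "Incl C \<subseteq> Mor C"
    and F: "is_functor C D F\<^sub>o F\<^sub>m"
    and bij: "bij_betw F\<^sub>o (Obj C) (Obj D)" "bij_betw F\<^sub>m (Mor C) (Mor D)"
    and incl: "F\<^sub>m ` Incl C = Incl D"
    and D: "\<And>g. g \<in> Mor D \<Longrightarrow> Dom D g \<in> Obj D \<and> Cod D g \<in> Obj D"
  shows "subobj_isomorphic C D"
proof -
  interpret C: small_category C by (rule C)
  let ?Go = "inv_into (Obj C) F\<^sub>o"
  let ?Gm = "inv_into (Mor C) F\<^sub>m"
  note fs = F[unfolded is_functor_def]
  have G1: "?Go (F\<^sub>o a) = a" if "a \<in> Obj C" for a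
    using bij_betw_inv_into_left[OF bij(1) that] .
  have G2: "?Gm (F\<^sub>m f) = f" if "f \<in> Mor C" for f
    using bij_betw_inv_into_left[OF bij(2) that] .
  have G3: "\<exists>a\<in>Obj C. b = F\<^sub>o a" if "b \<in> Obj D" for b
    using bij(1) that by (auto simp: bij_betw_def)
  have G4: "\<exists>f\<in>Mor C. g = F\<^sub>m f" if "g \<in> Mor D" for g
    using bij(2) that by (auto simp: bij_betw_def)
  have "is_functor D C ?Go ?Gm"
    unfolding is_functor_def
  proof (intro conjI ballI impI funcsetI)
    show "?Go b \<in> Obj C" if "b \<in> Obj D" for b
      using G3[OF that] G1 by auto
    show "?Gm g \<in> Mor C" if "g \<in> Mor D" for g
      using G4[OF that] G2 by auto
    show "Dom C (?Gm g) = ?Go (Dom D g)" "Cod C (?Gm g) = ?Go (Cod D g)" if "g \<in> Mor D" for g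
      using G4[OF that] G2 G1 fs C.Dom_Obj C.Cod_Obj by auto
    show "?Gm (Idt D b) = Idt C (?Go b)" if "b \<in> Obj D" for b
    proof -
      obtain a where "a \<in> Obj C" "b = F\<^sub>o a"
        using G3 \<open>b \<in> Obj D\<close> by blast
      then show ?thesis
        using G1 G2[of "Idt C a"] fs C.Idt_Hom[of a] by (auto simp: Hom_def)
    qed
    show "?Gm (g \<cdot>\<^bsub>D\<^esub> h) = ?Gm g \<cdot>\<^bsub>C\<^esub> ?Gm h" if gh: "g \<in> Mor D" "h \<in> Mor D" "Cod D g = Dom D h" for g h
    proof -
      obtain p q where pq: "p \<in> Mor C" "g = F\<^sub>m p" "q \<in> Mor C" "h = F\<^sub>m q"
        using gh G4 by metis
      then have "F\<^sub>o (Cod C p) = F\<^sub>o (Dom C q)"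
        using gh fs by auto
      \<comment> \<open>Injectivity on objects lifts composability from \<open>D\<close> back to
        \<open>C\<close>.\<close>
      then have "Cod C p = Dom C q"
        using G1 pq C.Dom_Obj C.Cod_Obj by metis
      then show ?thesis
        using pq G2 fs by (metis C.cmp_Mor(1))
    qed
  qed
  moreover have "?Gm ` Incl D \<subseteq> Incl C"
    using G2 C(2) unfolding incl[symmetric] by (auto simp: subset_iff)
  ultimately show ?thesis
    unfolding subobj_isomorphic_def
    using F G1 G2 incl bij_betw_inv_into_right[OF bij(1)] bij_betw_inv_into_right[OF bij(2)]
    by (intro exI[of _ F\<^sub>o] exI[of _ F\<^sub>m] exI[of _ ?Go] exI[of _ ?Gm]) auto
qed

section \<open>The isomorphism from \<open>C\<close> onto \<open>L_cat TC\<close>\<close>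

context unambiguous_category
begin

definition mor_map :: "'b \<Rightarrow> ('a \<Rightarrow> 'b) set_map" where
  "mor_map f = (ideal_at (Dom C f),
     (\<lambda>\<gamma>\<in>ideal_at (Dom C f). post \<gamma> (epart (inc (apex \<gamma>) (Dom C f) \<cdot> f))), ideal_at (Cod C f))"

lemma idem_at:
  assumes "c \<in> Obj C"
  obtains \<epsilon> where "\<epsilon> \<in> idems TC" "apex \<epsilon> = c"
  using cone_at[OF assms] by (metis idems_TC_iff)

text \<open>The component of \<open>\<epsilon>\<close> at \<open>apex \<gamma>\<close> is the
  inclusion into \<open>Dom C f\<close>, so multiplying by \<open>post \<epsilon> (epart f)\<close>
  first restricts \<open>f\<close> to \<open>apex \<gamma>\<close>, as \<open>mor_map\<close>
  does.\<close>

lemma mor_map_eq_rho: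
  assumes "f \<in> Mor C" "\<epsilon> \<in> idems TC" "apex \<epsilon> = Dom C f" "\<zeta> \<in> idems TC" "apex \<zeta> = Cod C f"
  shows "mor_map f = rho TC \<epsilon> (post \<epsilon> (epart f)) \<zeta>" "post \<epsilon> (epart f) \<in> corner TC \<epsilon> \<zeta>"
proof -
  have e: "cone \<epsilon>"
    using assms by (auto simp: idems_TC_iff)
  show "post \<epsilon> (epart f) \<in> corner TC \<epsilon> \<zeta>"
    using assms by (intro post_in_corner_TC) auto
  have "post \<gamma> (epart (inc (apex \<gamma>) (Dom C f) \<cdot> f)) = \<gamma> \<odot>\<^bsub>TC\<^esub> post \<epsilon> (epart f)"
    if "\<gamma> \<in> ideal_at (Dom C f)" for \<gamma>
  proof -
    have g: "cone \<gamma>" "apex \<gamma> \<sqsubseteq> Dom C f"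
      using that by (auto simp: ideal_at_def)
    then show ?thesis
      using idems_TC_inc(1)[OF assms(2), of "apex \<gamma>"] assms(1,3)
        epart_cmp_epart[of "inc (apex \<gamma>) (Dom C f)" f] by simp
  qed
  then show "mor_map f = rho TC \<epsilon> (post \<epsilon> (epart f)) \<zeta>"
    using assms by (auto simp: mor_map_def rho_def left_ideal_TC intro!: restrict_ext)
qed

text \<open>Every object \<open>a\<close> is the apex of some cone, which lies in
  \<open>ideal_at a\<close>; so containment of ideals gives \<open>\<sqsubseteq>\<close> between
  objects.\<close>

lemma ideal_at_inj: "inj_on ideal_at (Obj C)"
proof (rule inj_onI)
  fix c d assume cd: "c \<in> Obj C" "d \<in> Obj C" "ideal_at c = ideal_at d"
  have sub: "a \<sqsubseteq> b" if ab: "a \<in> Obj C" "ideal_at a \<subseteq> ideal_at b" for a b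
  proof -
    obtain \<mu> where \<mu>: "cone \<mu>" "apex \<mu> = a"
      using cone_at[OF ab(1)] .
    then have "\<mu> \<in> ideal_at a"
      using ab(1) by (simp add: ideal_at_def)
    then have "\<mu> \<in> ideal_at b"
      using ab(2) by blast
    then show ?thesis
      using \<mu> by (simp add: ideal_at_def)
  qed
  show "c = d"
    using sub[of c d] sub[of d c] cd by (intro sub_antisym) simp_all
qed

text \<open>Applying the map to an idempotent cone at \<open>Dom C f\<close> and reading the
  component there recovers \<open>epart f\<close>; together with the codomain this determines
  \<open>f\<close>.\<close>

lemma mor_map_inj: "inj_on mor_map (Mor C)"
proof (rule inj_onI)
  fix f g assume fg: "f \<in> Mor C" "g \<in> Mor C" "mor_map f = mor_map g"
  then have d: "Dom C f = Dom C g" "Cod C f = Cod C g"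
    using inj_onD[OF ideal_at_inj] by (auto simp: mor_map_def)
  obtain \<mu> where \<mu>: "cone \<mu>" "apex \<mu> = Dom C f" "\<mu> (Dom C f) = Idt C (Dom C f)"
    using cone_at[of "Dom C f"] fg by auto
  have mu: "\<mu> \<in> ideal_at (Dom C f)"
    using \<mu> fg by (simp add: ideal_at_def)
  have "post \<mu> (epart f) = post \<mu> (epart g)"
    using fun_cong[OF arg_cong[OF fg(3), of "\<lambda>m. fst (snd m)"], of \<mu>] mu \<mu> fg d
    by (simp add: mor_map_def)
  then have "post \<mu> (epart f) (Dom C f) = post \<mu> (epart g) (Dom C f)"
    by simp
  then have "epart f = epart g"
    using \<mu> fg d by simp
  then show "f = g"
    using epart_simps(5)[OF fg(1)] epart_simps(5)[OF fg(2)] d by metis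
qed

text \<open>Preservation of composition is \<open>epart_cmp\<close>, applied to \<open>f\<close>
  restricted to the apex of the argument and followed by \<open>g\<close>.\<close>

lemma is_functor_mor_map: "is_functor C (L_cat TC) ideal_at mor_map"
  unfolding is_functor_def
proof (intro conjI ballI impI funcsetI)
  show "ideal_at c \<in> Obj (L_cat TC)" if "c \<in> Obj C" for c
    using idem_at[OF that] left_ideal_TC by (auto simp: L_cat_def) metis
  show "mor_map f \<in> Mor (L_cat TC)" if "f \<in> Mor C" for f
  proof -
    obtain \<epsilon> where e: "\<epsilon> \<in> idems TC" "apex \<epsilon> = Dom C f"
      using idem_at[OF Dom_Obj[OF \<open>f \<in> Mor C\<close>]] .
    obtain \<zeta> where z: "\<zeta> \<in> idems TC" "apex \<zeta> = Cod C f"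
      using idem_at[OF Cod_Obj[OF \<open>f \<in> Mor C\<close>]] .
    show ?thesis
      using mor_map_eq_rho[OF that e z] e(1) z(1) by (auto simp: L_cat_def)
  qed
  show "Dom (L_cat TC) (mor_map f) = ideal_at (Dom C f)"
    "Cod (L_cat TC) (mor_map f) = ideal_at (Cod C f)" for f
    by (simp_all add: L_cat_def mor_map_def)
  show "mor_map (Idt C c) = Idt (L_cat TC) (ideal_at c)" if "c \<in> Obj C" for c
  proof -
    have "post \<gamma> (epart (inc (apex \<gamma>) c)) = \<gamma>" if "\<gamma> \<in> ideal_at c" for \<gamma>
    proof -
      have g: "cone \<gamma>" "apex \<gamma> \<sqsubseteq> c"
        using that by (auto simp: ideal_at_def)
      then have "epart (inc (apex \<gamma>) c) = Idt C (apex \<gamma>)"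
        using epart_eqI[of "Idt C (apex \<gamma>)" "inc (apex \<gamma>) c"] by (simp add: split_epi_Idt)
      then show ?thesis
        using g by (simp add: post_Idt)
    qed
    then show ?thesis
      using that by (auto simp: L_cat_def mor_map_def ideal_at_def intro!: restrict_ext)
  qed
  show "mor_map (f \<cdot> g) = mor_map f \<cdot>\<^bsub>L_cat TC\<^esub> mor_map g"
    if fg: "f \<in> Mor C" "g \<in> Mor C" "Cod C f = Dom C g" for f g
  proof -
    have "post \<gamma> (epart (inc (apex \<gamma>) (Dom C f) \<cdot> (f \<cdot> g)))
        = post (post \<gamma> (epart (inc (apex \<gamma>) (Dom C f) \<cdot> f)))
            (epart (inc (apex (post \<gamma> (epart (inc (apex \<gamma>) (Dom C f) \<cdot> f)))) (Dom C g) \<cdot> g))"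
      and "post \<gamma> (epart (inc (apex \<gamma>) (Dom C f) \<cdot> f)) \<in> ideal_at (Dom C g)"
      if "\<gamma> \<in> ideal_at (Dom C f)" for \<gamma>
    proof -
      have c: "cone \<gamma>" "apex \<gamma> \<sqsubseteq> Dom C f"
        using that by (auto simp: ideal_at_def)
      let ?h = "inc (apex \<gamma>) (Dom C f) \<cdot> f"
      have h: "?h \<in> Mor C" "Dom C ?h = apex \<gamma>" "Cod C ?h = Dom C g"
        using c fg by simp_all
      have s: "Cod C (epart ?h) \<sqsubseteq> Dom C g"
        using epart_simps(4)[OF h(1)] h by simp
      have p: "cone (post \<gamma> (epart ?h))" "apex (post \<gamma> (epart ?h)) = Cod C (epart ?h)"
        using c h by (simp_all add: cone_post)
      then show "post \<gamma> (epart ?h) \<in> ideal_at (Dom C g)"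
        using s by (simp add: ideal_at_def)
      have "inc (apex \<gamma>) (Dom C f) \<cdot> (f \<cdot> g) = ?h \<cdot> g"
        using c fg by (simp add: cmp_assoc_Mor)
      then have "epart (inc (apex \<gamma>) (Dom C f) \<cdot> (f \<cdot> g)) = epart ?h \<cdot> epart (inc (Cod C (epart ?h)) (Dom C g) \<cdot> g)"
        using epart_cmp[of ?h g] h fg by simp
      then show "post \<gamma> (epart (inc (apex \<gamma>) (Dom C f) \<cdot> (f \<cdot> g)))
          = post (post \<gamma> (epart ?h)) (epart (inc (apex (post \<gamma> (epart ?h))) (Dom C g) \<cdot> g))"
        unfolding p(2) using c h s fg by (simp add: post_post)
    qed
    then show ?thesis
      using fg by (auto simp: L_cat_def mor_map_def compose_def intro!: restrict_ext)
  qed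
qed

text \<open>The preimage is the component of \<open>u\<close> at \<open>apex \<epsilon>\<close>
  followed by the inclusion of \<open>apex u\<close> into \<open>apex \<zeta>\<close>; its
  epimorphic component is that component of \<open>u\<close>.\<close>

lemma Mor_L_cat_TC: "Mor (L_cat TC) \<subseteq> mor_map ` Mor C"
proof
  fix m assume "m \<in> Mor (L_cat TC)"
  then obtain \<epsilon> u \<zeta> where m: "m = rho TC \<epsilon> u \<zeta>" "\<epsilon> \<in> idems TC" "\<zeta> \<in> idems TC" "u \<in> corner TC \<epsilon> \<zeta>"
    by (auto simp: L_cat_def)
  have e: "cone \<epsilon>" "cone \<zeta>"
    using m by (auto simp: idems_TC_iff)
  note u = corner_TC[OF m(2-4)]
  let ?f = "u (apex \<epsilon>) \<cdot> inc (apex u) (apex \<zeta>)"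
  have f: "?f \<in> Mor C" "Dom C ?f = apex \<epsilon>" "Cod C ?f = apex \<zeta>"
    using u e by simp_all
  have "epart ?f = u (apex \<epsilon>)"
    using u e by (simp add: epart_eqI)
  then have "m = mor_map ?f"
    using mor_map_eq_rho(1)[of ?f \<epsilon> \<zeta>] f m u(3) by simp
  then show "m \<in> mor_map ` Mor C"
    using f by blast
qed

lemma mor_map_Incl:
  assumes "j \<in> Incl C"
  shows "mor_map j = (ideal_at (Dom C j), (\<lambda>\<gamma>\<in>ideal_at (Dom C j). \<gamma>), ideal_at (Cod C j))"
proof -
  have "post \<gamma> (epart (inc (apex \<gamma>) (Dom C j) \<cdot> j)) = \<gamma>" if "\<gamma> \<in> ideal_at (Dom C j)" for \<gamma>
  proof -
    have c: "cone \<gamma>" "apex \<gamma> \<sqsubseteq> Dom C j"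
      using that by (auto simp: ideal_at_def)
    have "inc (apex \<gamma>) (Dom C j) \<cdot> j \<in> Incl C"
      using c assms by (simp add: Incl_cmp)
    then have "epart (inc (apex \<gamma>) (Dom C j) \<cdot> j) = Idt C (apex \<gamma>)"
      using epart_eqI[of "Idt C (apex \<gamma>)" "inc (apex \<gamma>) (Dom C j) \<cdot> j"] c assms
      by (simp add: split_epi_Idt)
    then show ?thesis
      using c by (simp add: post_Idt)
  qed
  then show ?thesis
    by (auto simp: mor_map_def intro!: restrict_ext)
qed

lemma rho_TC_incl:
  assumes "\<epsilon> \<in> idems TC"
  shows "rho TC \<epsilon> \<epsilon> \<zeta> = (ideal_at (apex \<epsilon>), (\<lambda>\<gamma>\<in>ideal_at (apex \<epsilon>). \<gamma>), left_ideal TC \<zeta>)"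
  using idems_TC_inc(2)[OF assms]
  by (auto simp: rho_def left_ideal_TC[OF assms] ideal_at_def post_Idt intro!: restrict_ext)

text \<open>Both sides consist of set inclusions between ideals \<open>ideal_at c\<close>, and these
  ideals are nested exactly as the objects are.\<close>

lemma mor_map_image_Incl: "mor_map ` Incl C = Incl (L_cat TC)"
proof (intro subset_antisym subsetI)
  fix m assume "m \<in> mor_map ` Incl C"
  then obtain j where j: "j \<in> Incl C" "m = mor_map j"
    by blast
  obtain \<epsilon> where e: "\<epsilon> \<in> idems TC" "apex \<epsilon> = Dom C j"
    using idem_at[OF Dom_Obj[OF Incl_in_Mor[OF j(1)]]] .
  obtain \<zeta> where z: "\<zeta> \<in> idems TC" "apex \<zeta> = Cod C j"
    using idem_at[OF Cod_Obj[OF Incl_in_Mor[OF j(1)]]] .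
  have "ideal_at (Dom C j) \<subseteq> ideal_at (Cod C j)"
    using sub_trans sub_Incl[OF j(1)] by (auto simp: ideal_at_def)
  moreover have "m = rho TC \<epsilon> \<epsilon> \<zeta>"
    using j e z by (simp add: mor_map_Incl rho_TC_incl left_ideal_TC)
  ultimately show "m \<in> Incl (L_cat TC)"
    using e z left_ideal_TC[OF e(1)] left_ideal_TC[OF z(1)] by (force simp: L_cat_def)
next
  fix m assume "m \<in> Incl (L_cat TC)"
  then obtain \<epsilon> \<zeta> where m: "m = rho TC \<epsilon> \<epsilon> \<zeta>" "\<epsilon> \<in> idems TC" "\<zeta> \<in> idems TC"
      "left_ideal TC \<epsilon> \<subseteq> left_ideal TC \<zeta>"
    by (auto simp: L_cat_def)
  have "cone \<epsilon>"
    using m by (auto simp: idems_TC_iff)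
  then have "\<epsilon> \<in> ideal_at (apex \<zeta>)"
    using m left_ideal_TC by (auto simp: ideal_at_def)
  then have s: "apex \<epsilon> \<sqsubseteq> apex \<zeta>"
    by (simp add: ideal_at_def)
  have "m = mor_map (inc (apex \<epsilon>) (apex \<zeta>))"
    using m s by (simp add: mor_map_Incl rho_TC_incl left_ideal_TC)
  then show "m \<in> mor_map ` Incl C"
    using s by simp
qed

lemma isomorphic_L_cat_TC: "subobj_isomorphic C (L_cat TC)"
proof (rule subobj_isomorphicI)
  show "small_category C" "Incl C \<subseteq> Mor C"
    by (rule small_category_axioms, rule Incl_Mor)
  note F = is_functor_mor_map[unfolded is_functor_def]
  show "is_functor C (L_cat TC) ideal_at mor_map"
    by (rule is_functor_mor_map)
  have "Obj (L_cat TC) \<subseteq> ideal_at ` Obj C"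
    by (auto simp: L_cat_def left_ideal_TC idems_TC_iff)
  then show "bij_betw ideal_at (Obj C) (Obj (L_cat TC))"
    using F ideal_at_inj by (auto simp: bij_betw_def)
  show "bij_betw mor_map (Mor C) (Mor (L_cat TC))"
    using F mor_map_inj Mor_L_cat_TC by (auto simp: bij_betw_def)
  show "mor_map ` Incl C = Incl (L_cat TC)"
    by (rule mor_map_image_Incl)
  show "Dom (L_cat TC) g \<in> Obj (L_cat TC) \<and> Cod (L_cat TC) g \<in> Obj (L_cat TC)"
    if "g \<in> Mor (L_cat TC)" for g
    using that by (auto simp: L_cat_def rho_def)
qed

end

text \<open>The cone semigroup consists of functions from objects to morphisms, which fixes the type
  in the equivalence. The second conjunct gives necessity of unambiguity for semigroups over an
  arbitrary type.\<close>

theorem corollary2p11: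
  fixes C :: "('o, 'm) subobj_category"
  assumes "category_with_subobjects C"
  shows "((\<exists>S :: ('o \<Rightarrow> 'm) sgrp. locally_inverse_semigroup S \<and> subobj_isomorphic C (L_cat S))
            \<longleftrightarrow> unambiguous_category C) \<and>
         (\<forall>S :: 's sgrp. locally_inverse_semigroup S \<and> subobj_isomorphic C (L_cat S)
            \<longrightarrow> unambiguous_category C)"
proof (intro conjI iffI allI impI)
  show "unambiguous_category C"
    if "\<exists>S :: ('o \<Rightarrow> 'm) sgrp. locally_inverse_semigroup S \<and> subobj_isomorphic C (L_cat S)"
    using that unambiguous_if_isomorphic_L_cat[OF assms] by blast
  show "unambiguous_category C"
    if "locally_inverse_semigroup S \<and> subobj_isomorphic C (L_cat S)" for S :: "'s sgrp"
    using that unambiguous_if_isomorphic_L_cat[OF assms] by blast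
  show "\<exists>S :: ('o \<Rightarrow> 'm) sgrp. locally_inverse_semigroup S \<and> subobj_isomorphic C (L_cat S)"
    if "unambiguous_category C"
    using unambiguous_category.locally_inverse_semigroup_TC[OF that]
      unambiguous_category.isomorphic_L_cat_TC[OF that] by blast
qed

end
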